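(* Let $J\subseteq\mathcal L(X)$ be a nonempty upper set and let $x\in X$ be a coloop. For every integer $k\ge0$, \[\operatorname{Hilb}(\mathcal P(X,k,J),t)=\begin{cases}\sum_{j=0}^{k}t^{j+1}\operatorname{Hilb}(\mathcal P(X/x,k-j,\widehat{J/x}),t)+\operatorname{Hilb}(\mathcal P(X/x,k,J/x),t)&\text{if }X\setminus x\in J,\\ \sum_{j=0}^{k-1}t^{j+1}\operatorname{Hilb}(\mathcal P(X/x,k-j,\widehat{J/x}),t)+\operatorname{Hilb}(\mathcal P(X/x,k,J/x),t)&\text{if }X\setminus x\notin J.\end{cases}\] For $k=-1$, \[\operatorname{Hilb}(\ker\mathcal I(X,-1,J),t)=\begin{cases}\operatorname{Hilb}(\ker\mathcal I(X/x,-1,J/x),t)&\text{if }X\setminus x\in J,\\0&\text{if }X\setminus x\notin J.\end{cases}\]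
   Context: Let $\mathbb{K}$ be a field of characteristic zero, $V$ a $\mathbb{K}$-vector space of finite dimension $r\ge 1$, $U=V^*$, and $X=(x_1,\dots,x_N)$ a finite sequence in $U$ spanning $U$. Subsequences are taken with respect to indices; $X\setminus Y$ is the complementary subsequence. $\operatorname{rank}(Y)$ is the dimension of the span; $\operatorname{clos}_X(Y)=\{z\in X:\operatorname{rank}(Y\cup z)=\operatorname{rank}(Y)\}$; flats are $C$ with $\operatorname{clos}_X(C)=C$; $\mathcal L(X)$ is the lattice of flats. An upper set $J$ is closed under passing to larger flats; $\chi=\chi_J$ is its indicator, extended by $\chi(A)=\chi(\operatorname{clos}(A))$. For $\eta\in V$, $\{z\in X:\eta(z)=0\}$ is the flat defined by $\eta$; $m(C)=|X\setminus C|$, $m(\eta)=m(C)$, $\chi(\eta)=\chi(C)$ for $C$ the flat defined by $\eta$. $x$ is a coloop if $\operatorname{rank}(X\setminus x)=r-1$ (then $X\setminus x$ is a flat). $p_u$ is the image of $u\in U$ in $\operatorname{Sym}(U)$, $p_Y=\prod_{z\in Y}p_z$; $D_v$ is the image of $v\in V$ in $\operatorname{Sym}(V)$, acting on $\operatorname{Sym}(U)$ as the derivation with $D_v(u)=v(u)$. $\ker\mathcal I=\{f\in\operatorname{Sym}(U):q\cdot f=0\ \forall q\in\mathcal I\}$; $\mathcal I(X,k,J)=\operatorname{ideal}\{D_\eta^{m(\eta)+k+\chi(\eta)}:\eta\in V\setminus\{0\}\}$. For $k\ge1$, $S(X,k,J)=\{fp_Y: Y\subseteq X,\ f\in\operatorname{Sym}(U),\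 \deg f\le\chi(X\setminus Y)+k-1\}$, $S(X,0,J)=\{p_Y:\operatorname{clos}(X\setminus Y)\in J\}$, and $\mathcal P(X,k,J)=\operatorname{span}S(X,k,J)$. $\operatorname{Hilb}(W,t)=\sum_i\dim(W_i)t^i$ for a graded subspace $W$. $X/x$ is the sequence of images of the entries of $X\setminus x$ under the projection $U\to U/\mathbb Kx$ (spanning $U/\mathbb Kx$, whose dual is $\{v\in V:v(x)=0\}$); all constructions are applied to $X/x$ likewise. For $Y\subseteq X\setminus x$, $\bar Y$ is the subsequence of $X/x$ with the same index set. $J/x=\{\overline{C\setminus x}: x\in C\in J\}\subseteq\mathcal L(X/x)$, and, for $x$ a coloop, $\widehat{J/x}=\{\bar C: C\in J,\ x\notin C\}\cup\{\overline{X\setminus x}\}$, an upper set in $\mathcal L(X/x)$. *)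

theory Defs
  imports
    "HOL-Library.Poly_Mapping"
    "HOL-Library.Function_Algebras"
    "HOL-Computational_Algebra.Formal_Power_Series"
begin

section \<open>Dual spaces\<close>

text \<open>
  The vector space \<open>V\<close> is a subspace of a vector space on the type \<open>'v\<close> with scalar
  multiplication \<open>scale\<close> over the field \<open>'a\<close>. Its dual \<open>U\<close> is a set of functions
  \<open>'v \<Rightarrow> 'a\<close>; such a functional is given the value \<open>0\<close> outside \<open>V\<close>, so that functionals on \<open>V\<close>
  are equal iff they are equal as functions.
\<close>

definition fscale :: "'a::field \<Rightarrow> ('v \<Rightarrow> 'a) \<Rightarrow> ('v \<Rightarrow> 'a)" where
  "fscale c u = (\<lambda>v. c * u v)"

global_interpretation fn: vector_space "fscale :: 'a::field \<Rightarrow> ('v \<Rightarrow> 'a) \<Rightarrow> ('v \<Rightarrow> 'a)"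
  by unfold_locales (auto simp: fscale_def fun_eq_iff algebra_simps)

definition dual_space ::
    "('a::field \<Rightarrow> 'v::ab_group_add \<Rightarrow> 'v) \<Rightarrow> 'v set \<Rightarrow> ('v \<Rightarrow> 'a) set" where
  "dual_space scale V = {u. (\<forall>v\<in>V. \<forall>w\<in>V. u (v + w) = u v + u w)
      \<and> (\<forall>c. \<forall>v\<in>V. u (scale c v) = c * u v) \<and> (\<forall>v. v \<notin> V \<longrightarrow> u v = 0)}"

definition is_basis :: "('a::field \<Rightarrow> 'v::ab_group_add \<Rightarrow> 'v) \<Rightarrow> 'v set \<Rightarrow> 'v set \<Rightarrow> bool" where
  "is_basis scale V B \<longleftrightarrow> finite B \<and> \<not> module.dependent scale B \<and> module.span scale B = V"

section \<open>Symmetric algebras\<close>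

text \<open>
  Let \<open>B\<close> be a basis of \<open>V\<close>. Both \<open>Sym(V)\<close> and \<open>Sym(U)\<close> are polynomial rings with
  variables indexed by \<open>B\<close>: in \<open>Sym(V)\<close> the variable \<open>b\<close> stands for the basis vector \<open>b\<close>,
  in \<open>Sym(U)\<close> for the corresponding element of the dual basis. A polynomial is a finitely
  supported function from monomials (finitely supported exponent functions) to coefficients.
\<close>

type_synonym ('v, 'a) mpoly = "('v \<Rightarrow>\<^sub>0 nat) \<Rightarrow>\<^sub>0 'a"

definition sym_alg :: "'v set \<Rightarrow> ('v, 'a::field) mpoly set" where
  "sym_alg B = {f. \<forall>m\<in>Poly_Mapping.keys f. Poly_Mapping.keys m \<subseteq> B}"

definition const :: "'a::field \<Rightarrow> ('v, 'a) mpoly" where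
  "const c = Poly_Mapping.single 0 c"

definition var :: "'v \<Rightarrow> ('v, 'a::field) mpoly" where
  "var b = Poly_Mapping.single (Poly_Mapping.single b 1) 1"

definition pscale :: "'a::field \<Rightarrow> ('v, 'a) mpoly \<Rightarrow> ('v, 'a) mpoly" where
  "pscale c f = const c * f"

lemma const_add: "const (a + b) = const a + const b"
  by (simp add: const_def single_add)

lemma const_mult: "const (a * b) = const a * const b"
  by (simp add: const_def mult_single)

lemma const_1 [simp]: "const 1 = 1"
  by (simp add: const_def)

lemma const_sum: "const (\<Sum>i\<in>S. h i) = (\<Sum>i\<in>S. const (h i))"
  by (induction S rule: infinite_finite_induct) (simp_all add: const_add, simp_all add: const_def)

global_interpretation pm: vector_space "pscale :: 'a::field \<Rightarrow> ('v, 'a) mpoly \<Rightarrow> ('v, 'a) mpoly"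
  by unfold_locales (simp_all add: pscale_def const_add const_mult algebra_simps)

text \<open>The image \<open>D\<^sub>v\<close> of \<open>v \<in> V\<close> in \<open>Sym(V)\<close>, and the image \<open>p\<^sub>u\<close> of \<open>u \<in> U\<close> in \<open>Sym(U)\<close>
  (the coordinates of \<open>u\<close> in the dual basis are its values on \<open>B\<close>).\<close>

definition D_elt :: "('a::field \<Rightarrow> 'v::ab_group_add \<Rightarrow> 'v) \<Rightarrow> 'v set \<Rightarrow> 'v \<Rightarrow> ('v, 'a) mpoly" where
  "D_elt scale B v = (\<Sum>b\<in>B. pscale (module.representation scale B v b) (var b))"

definition p_elt :: "'v set \<Rightarrow> ('v \<Rightarrow> 'a::field) \<Rightarrow> ('v, 'a) mpoly" where
  "p_elt B u = (\<Sum>b\<in>B. pscale (u b) (var b))"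

definition p_prod :: "'v set \<Rightarrow> ('i \<Rightarrow> 'v \<Rightarrow> 'a::field) \<Rightarrow> 'i set \<Rightarrow> ('v, 'a) mpoly" where
  "p_prod B X Y = (\<Prod>j\<in>Y. p_elt B (X j))"

definition mdeg :: "('v \<Rightarrow>\<^sub>0 nat) \<Rightarrow> nat" where
  "mdeg m = (\<Sum>b\<in>Poly_Mapping.keys m. Poly_Mapping.lookup m b)"

definition deg_le :: "('v, 'a::field) mpoly \<Rightarrow> nat \<Rightarrow> bool" where
  "deg_le f d \<longleftrightarrow> (\<forall>m\<in>Poly_Mapping.keys f. mdeg m \<le> d)"

definition homogeneous :: "nat \<Rightarrow> ('v, 'a::field) mpoly set" where
  "homogeneous d = {f. \<forall>m\<in>Poly_Mapping.keys f. mdeg m = d}"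

definition Hilb :: "('v, 'a::field) mpoly set \<Rightarrow> int fps" where
  "Hilb W = Abs_fps (\<lambda>d. int (pm.dim (W \<inter> homogeneous d)))"

text \<open>
  The action of \<open>Sym(V)\<close> on \<open>Sym(U)\<close>: a monomial \<open>m\<close> acts as the iterated partial derivative
  \<open>\<partial>\<^sup>m\<close>, and \<open>\<partial>\<^sup>m\<close> of a monomial \<open>n\<close> is \<open>\<Prod>b. n b (n b - 1) \<dots> (n b - m b + 1)\<close> times the
  monomial \<open>n - m\<close>. If \<open>m b > n b\<close> for some \<open>b\<close> then this coefficient is \<open>0\<close>, and the truncated
  subtraction \<open>n - m\<close> is irrelevant. The lemmas below show that this is the module structure for
  which \<open>D\<^sub>v\<close> acts as the derivation with \<open>D\<^sub>v(u) = u(v)\<close>.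
\<close>

definition diff_coeff :: "('v \<Rightarrow>\<^sub>0 nat) \<Rightarrow> ('v \<Rightarrow>\<^sub>0 nat) \<Rightarrow> nat" where
  "diff_coeff m n = (\<Prod>b\<in>Poly_Mapping.keys m.
      fact (Poly_Mapping.lookup m b) * (Poly_Mapping.lookup n b choose Poly_Mapping.lookup m b))"

definition sym_act :: "('v, 'a::field) mpoly \<Rightarrow> ('v, 'a) mpoly \<Rightarrow> ('v, 'a) mpoly" where
  "sym_act q f = (\<Sum>m\<in>Poly_Mapping.keys q. \<Sum>n\<in>Poly_Mapping.keys f.
      Poly_Mapping.single (n - m)
        (Poly_Mapping.lookup q m * Poly_Mapping.lookup f n * of_nat (diff_coeff m n)))"

definition sym_ideal :: "'v set \<Rightarrow> ('v, 'a::field) mpoly set \<Rightarrow> ('v, 'a) mpoly set" where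
  "sym_ideal B G = {\<Sum>g\<in>F. h g * g | F h. finite F \<and> F \<subseteq> G \<and> (\<forall>g\<in>F. h g \<in> sym_alg B)}"

definition ker :: "'v set \<Rightarrow> ('v, 'a::field) mpoly set \<Rightarrow> ('v, 'a) mpoly set" where
  "ker B \<I> = {f \<in> sym_alg B. \<forall>q\<in>\<I>. sym_act q f = 0}"

subsection \<open>The action is the one determined by the derivations\<close>

lemma sym_act_superset:
  assumes "finite A" "Poly_Mapping.keys q \<subseteq> A" "finite C" "Poly_Mapping.keys f \<subseteq> C"
  shows "sym_act q f = (\<Sum>m\<in>A. \<Sum>n\<in>C. Poly_Mapping.single (n - m)
        (Poly_Mapping.lookup q m * Poly_Mapping.lookup f n * of_nat (diff_coeff m n)))"
proof -
  have "sym_act q f = (\<Sum>m\<in>Poly_Mapping.keys q. \<Sum>n\<in>C. Poly_Mapping.single (n - m)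
        (Poly_Mapping.lookup q m * Poly_Mapping.lookup f n * of_nat (diff_coeff m n)))"
    unfolding sym_act_def
    by (intro sum.cong refl sum.mono_neutral_left) (use assms in \<open>auto simp: in_keys_iff\<close>)
  also have "\<dots> = (\<Sum>m\<in>A. \<Sum>n\<in>C. Poly_Mapping.single (n - m)
        (Poly_Mapping.lookup q m * Poly_Mapping.lookup f n * of_nat (diff_coeff m n)))"
    by (intro sum.mono_neutral_left) (use assms in \<open>auto simp: in_keys_iff\<close>)
  finally show ?thesis .
qed

lemma sym_act_add_left: "sym_act (q + q') f = sym_act q f + sym_act q' f"
proof -
  let ?A = "Poly_Mapping.keys q \<union> Poly_Mapping.keys q'"
  let ?C = "Poly_Mapping.keys f"
  have "Poly_Mapping.keys (q + q') \<subseteq> ?A" by (rule keys_add)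
  then show ?thesis
    by (subst (1 2 3) sym_act_superset[where A = ?A and C = ?C])
       (auto simp: lookup_add single_add algebra_simps sum.distrib)
qed

lemma sym_act_add_right: "sym_act q (f + f') = sym_act q f + sym_act q f'"
proof -
  let ?A = "Poly_Mapping.keys q"
  let ?C = "Poly_Mapping.keys f \<union> Poly_Mapping.keys f'"
  have "Poly_Mapping.keys (f + f') \<subseteq> ?C" by (rule keys_add)
  then show ?thesis
    by (subst (1 2 3) sym_act_superset[where A = ?A and C = ?C])
       (auto simp: lookup_add single_add algebra_simps sum.distrib)
qed

lemma sym_act_single: "sym_act (Poly_Mapping.single m a) (Poly_Mapping.single n c)
    = Poly_Mapping.single (n - m) (a * c * of_nat (diff_coeff m n))"
  by (subst sym_act_superset[where A = "{m}" and C = "{n}"]) auto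

lemma sym_act_0 [simp]: "sym_act 0 f = 0" "sym_act q 0 = 0"
  by (simp_all add: sym_act_def)

lemma sym_act_sum_left: "sym_act (\<Sum>i\<in>S. q i) f = (\<Sum>i\<in>S. sym_act (q i) f)"
  by (induction S rule: infinite_finite_induct) (simp_all add: sym_act_add_left)

lemma sym_act_sum_right: "sym_act q (\<Sum>i\<in>S. f i) = (\<Sum>i\<in>S. sym_act q (f i))"
  by (induction S rule: infinite_finite_induct) (simp_all add: sym_act_add_right)

lemma mpoly_sum_single:
  "f = (\<Sum>m\<in>Poly_Mapping.keys f. Poly_Mapping.single m (Poly_Mapping.lookup f m))"
  by (rule poly_mapping_eqI)
     (simp add: lookup_sum lookup_single when_def in_keys_iff)

lemma mpoly_induct [case_names single add]:
  fixes P :: "('v, 'a::field) mpoly \<Rightarrow> bool"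
  assumes "\<And>m c. P (Poly_Mapping.single m c)" "\<And>f g. P f \<Longrightarrow> P g \<Longrightarrow> P (f + g)"
  shows "P f"
proof -
  have "P (\<Sum>m\<in>A. Poly_Mapping.single m (h m))" if "finite A" for A h
    using that
  proof (induction A)
    case empty
    then show ?case using assms(1)[of 0 0] by simp
  qed (use assms in auto)
  then show ?thesis by (subst mpoly_sum_single) auto
qed

lemma diff_coeff_superset:
  assumes "finite A" "Poly_Mapping.keys m \<subseteq> A"
  shows "diff_coeff m n = (\<Prod>b\<in>A.
      fact (Poly_Mapping.lookup m b) * (Poly_Mapping.lookup n b choose Poly_Mapping.lookup m b))"
  unfolding diff_coeff_def
  by (rule prod.mono_neutral_left) (use assms in \<open>auto simp: in_keys_iff\<close>)

lemma diff_coeff_add: "diff_coeff (m + m') n = diff_coeff m (n - m') * diff_coeff m' n"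
proof -
  let ?A = "Poly_Mapping.keys m \<union> Poly_Mapping.keys m'"
  have *: "fact (a + b) * (k choose (a + b)) = fact a * (k - b choose a) * (fact b * (k choose b))"
    for a b k :: nat
  proof (cases "a + b \<le> k")
    case True
    have 1: "fact (a + b) * fact (k - (a + b)) * (k choose (a + b)) = fact k"
      using True by (rule binomial_fact_lemma)
    have 2: "fact b * fact (k - b) * (k choose b) = fact k"
      using True by (intro binomial_fact_lemma) auto
    have 3: "fact a * fact (k - b - a) * (k - b choose a) = fact (k - b)"
      using True by (intro binomial_fact_lemma) auto
    have e: "k - (a + b) = k - b - a" by simp
    have "fact (k - b - a) * (fact (a + b) * (k choose (a + b)))
        = fact (k - b - a) * (fact a * (k - b choose a) * (fact b * (k choose b)))"
      using 1 2 unfolding e 3[symmetric] by (simp add: mult_ac)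
    then show ?thesis by (metis mult_left_cancel fact_nonzero)
  next
    case False
    then have "k - b < a \<or> k < b" by linarith
    then show ?thesis using False by (auto simp: binomial_eq_0)
  qed
  have "Poly_Mapping.keys (m + m') \<subseteq> ?A" by (rule keys_add)
  then show ?thesis
    by (simp add: diff_coeff_superset[where A = ?A] lookup_add lookup_minus * prod.distrib)
qed

lemma sym_act_one: "sym_act 1 f = f"
proof (induction f rule: mpoly_induct)
  case (single m c)
  have "sym_act (Poly_Mapping.single 0 1) (Poly_Mapping.single m c) = Poly_Mapping.single m c"
    by (subst sym_act_single) (simp add: diff_coeff_def)
  then show ?case by simp
qed (simp add: sym_act_add_right)

lemma sym_act_mult: "sym_act (q * q') f = sym_act q (sym_act q' f)"
proof (induction q rule: mpoly_induct)
  case (single m a)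
  show ?case
  proof (induction q' rule: mpoly_induct)
    case (single m' a')
    show ?case
    proof (induction f rule: mpoly_induct)
      case (single n c)
      have *: "n - (m + m') = n - m' - m"
        by (metis add.commute diff_diff_add)
      show ?case
        by (simp only: sym_act_single mult_single diff_coeff_add of_nat_mult *) (simp only: mult_ac)
    qed (simp add: sym_act_add_right)
  qed (simp add: sym_act_add_left sym_act_add_right algebra_simps)
qed (simp add: sym_act_add_left algebra_simps)

lemma diff_coeff_var: "diff_coeff (Poly_Mapping.single b 1) n = Poly_Mapping.lookup n b"
  by (simp add: diff_coeff_def)

lemma sym_act_var_mult:
  "sym_act (pscale a (var b)) (f * g)
    = sym_act (pscale a (var b)) f * g + f * sym_act (pscale a (var b)) g"
proof -
  have v: "pscale a (var b) = Poly_Mapping.single (Poly_Mapping.single b 1) a"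
    by (simp add: pscale_def const_def var_def mult_single)
  have shift: "Poly_Mapping.single (n + n' - Poly_Mapping.single b 1) (x * of_nat (Poly_Mapping.lookup n b))
      = Poly_Mapping.single ((n - Poly_Mapping.single b 1) + n') (x * of_nat (Poly_Mapping.lookup n b))"
    for n n' :: "'a \<Rightarrow>\<^sub>0 nat" and x :: 'b
  proof (cases "Poly_Mapping.lookup n b = 0")
    case False
    have "n + n' - Poly_Mapping.single b 1 = (n - Poly_Mapping.single b 1) + n'"
      by (rule poly_mapping_eqI)
         (use False in \<open>auto simp: lookup_add lookup_minus lookup_single when_def\<close>)
    then show ?thesis by simp
  qed simp
  show ?thesis
  proof (induction f rule: mpoly_induct)
    case (single n c)
    show ?case
    proof (induction g rule: mpoly_induct)
      case (single n' c')
      have "sym_act (pscale a (var b)) (Poly_Mapping.single n c * Poly_Mapping.single n' c')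
        = Poly_Mapping.single (n + n' - Poly_Mapping.single b 1)
              (a * c * c' * of_nat (Poly_Mapping.lookup n b))
          + Poly_Mapping.single (n' + n - Poly_Mapping.single b 1)
              (a * c * c' * of_nat (Poly_Mapping.lookup n' b))"
        by (simp add: v mult_single sym_act_single diff_coeff_var[unfolded One_nat_def] lookup_add
            single_add[symmetric] algebra_simps)
      also have "\<dots> = sym_act (pscale a (var b)) (Poly_Mapping.single n c) * Poly_Mapping.single n' c'
          + Poly_Mapping.single n c * sym_act (pscale a (var b)) (Poly_Mapping.single n' c')"
        unfolding shift
        by (simp add: v mult_single sym_act_single diff_coeff_var[unfolded One_nat_def] add.commute mult_ac)
      finally show ?case .
    qed (simp add: sym_act_add_right algebra_simps)
  qed (simp add: sym_act_add_right algebra_simps)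
qed

lemma sym_act_D_elt_mult:
  "sym_act (D_elt scale B v) (f * g)
    = sym_act (D_elt scale B v) f * g + f * sym_act (D_elt scale B v) g"
  by (simp add: D_elt_def sym_act_sum_left sym_act_var_mult sum.distrib sum_distrib_left
      sum_distrib_right)

lemma sym_act_D_elt_p_elt:
  assumes "vector_space scale" "is_basis scale V B" "u \<in> dual_space scale V" "v \<in> V"
  shows "sym_act (D_elt scale B v) (p_elt B u) = const (u v)"
proof -
  interpret vector_space scale by fact
  let ?r = "representation B v"
  have B: "finite B" "independent B" "span B = V"
    using assms(2) by (auto simp: is_basis_def)
  have vv: "sym_act (pscale a (var b)) (pscale c (var b')) = (if b = b' then const (a * c) else 0)"
    for a c and b b' :: 'b
    by (simp add: pscale_def const_def var_def mult_single sym_act_single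
        diff_coeff_var[unfolded One_nat_def] lookup_single)
  have "sym_act (D_elt scale B v) (p_elt B u) = (\<Sum>b\<in>B. \<Sum>b'\<in>B. if b = b' then const (?r b * u b') else 0)"
    by (simp only: D_elt_def p_elt_def sym_act_sum_left sym_act_sum_right vv) (rule sum.swap)
  also have "\<dots> = (\<Sum>b\<in>B. const (?r b * u b))"
    using B(1) by simp
  also have "\<dots> = const (\<Sum>b\<in>B. ?r b * u b)"
    by (simp add: const_sum)
  also have "(\<Sum>b\<in>B. ?r b * u b) = u (\<Sum>b\<in>B. scale (?r b) b)"
  proof -
    have lin: "\<And>x y. x \<in> V \<Longrightarrow> y \<in> V \<Longrightarrow> u (x + y) = u x + u y"
      "\<And>c x. x \<in> V \<Longrightarrow> u (scale c x) = c * u x"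
      using assms(3) by (auto simp: dual_space_def)
    have V: "subspace V" using B(3) by auto
    have u0: "u 0 = 0" using lin(2)[of 0 0] V by (simp add: subspace_0)
    have "C \<subseteq> V \<Longrightarrow> (\<Sum>b\<in>C. ?r b * u b) = u (\<Sum>b\<in>C. scale (?r b) b)" if "finite C" for C
      using that
    proof (induction C)
      case (insert c C)
      then show ?case
        using V by (simp add: lin subspace_scale subspace_sum subset_iff)
    qed (simp add: u0)
    moreover have "B \<subseteq> V" using B(3) span_superset by blast
    ultimately show ?thesis using B(1) by blast
  qed
  also have "(\<Sum>b\<in>B. scale (?r b) b) = v"
    using B assms(4) by (intro sum_representation_eq) auto
  finally show ?thesis .
qed

section \<open>Flats\<close>

text \<open>
  A finite sequence in \<open>U\<close> is a function \<open>X\<close> together with its finite index set \<open>I\<close>;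
  subsequences, and in particular flats, are subsets of \<open>I\<close>. Entries of \<open>X\<close> outside \<open>I\<close> play
  no role.
\<close>

definition rank :: "('i \<Rightarrow> 'v \<Rightarrow> 'a::field) \<Rightarrow> 'i set \<Rightarrow> nat" where
  "rank X Y = fn.dim (X ` Y)"

definition clos :: "('i \<Rightarrow> 'v \<Rightarrow> 'a::field) \<Rightarrow> 'i set \<Rightarrow> 'i set \<Rightarrow> 'i set" where
  "clos X I Y = {j\<in>I. rank X (insert j Y) = rank X Y}"

definition flats :: "('i \<Rightarrow> 'v \<Rightarrow> 'a::field) \<Rightarrow> 'i set \<Rightarrow> 'i set set" where
  "flats X I = {C. C \<subseteq> I \<and> clos X I C = C}"

definition upper_set :: "('i \<Rightarrow> 'v \<Rightarrow> 'a::field) \<Rightarrow> 'i set \<Rightarrow> 'i set set \<Rightarrow> bool" where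
  "upper_set X I J \<longleftrightarrow> J \<subseteq> flats X I \<and> (\<forall>C\<in>J. \<forall>D\<in>flats X I. C \<subseteq> D \<longrightarrow> D \<in> J)"

definition chi :: "('i \<Rightarrow> 'v \<Rightarrow> 'a::field) \<Rightarrow> 'i set \<Rightarrow> 'i set set \<Rightarrow> 'i set \<Rightarrow> nat" where
  "chi X I J A = (if clos X I A \<in> J then 1 else 0)"

definition flat_of :: "('i \<Rightarrow> 'v \<Rightarrow> 'a::field) \<Rightarrow> 'i set \<Rightarrow> 'v \<Rightarrow> 'i set" where
  "flat_of X I \<eta> = {j\<in>I. X j \<eta> = 0}"

section \<open>Power ideals and their kernels\<close>

text \<open>
  The exponent \<open>m(\<eta>) + k + \<chi>(\<eta>)\<close> is nonnegative for \<open>k \<ge> -1\<close>, because \<open>m(\<eta>) \<ge> 1\<close> for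
  \<open>\<eta> \<noteq> 0\<close> when the sequence spans \<open>U\<close>. Here \<open>V\<close> is \<open>span B\<close>.
\<close>

definition power_ideal ::
    "('a::field \<Rightarrow> 'v::ab_group_add \<Rightarrow> 'v) \<Rightarrow> 'v set \<Rightarrow> ('i \<Rightarrow> 'v \<Rightarrow> 'a) \<Rightarrow> 'i set \<Rightarrow> int
      \<Rightarrow> 'i set set \<Rightarrow> ('v, 'a) mpoly set" where
  "power_ideal scale B X I k J = sym_ideal B
     {D_elt scale B \<eta> ^ nat (int (card (I - flat_of X I \<eta>)) + k + int (chi X I J (flat_of X I \<eta>)))
       | \<eta>. \<eta> \<in> module.span scale B - {0}}"

definition S_gens ::
    "'v set \<Rightarrow> ('i \<Rightarrow> 'v \<Rightarrow> 'a::field) \<Rightarrow> 'i set \<Rightarrow> nat \<Rightarrow> 'i set set \<Rightarrow> ('v, 'a) mpoly set" where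
  "S_gens B X I k J =
     (if k = 0 then {p_prod B X Y | Y. Y \<subseteq> I \<and> clos X I (I - Y) \<in> J}
      else {f * p_prod B X Y | f Y. Y \<subseteq> I \<and> f \<in> sym_alg B \<and> deg_le f (chi X I J (I - Y) + k - 1)})"

definition P_space ::
    "'v set \<Rightarrow> ('i \<Rightarrow> 'v \<Rightarrow> 'a::field) \<Rightarrow> 'i set \<Rightarrow> nat \<Rightarrow> 'i set set \<Rightarrow> ('v, 'a) mpoly set" where
  "P_space B X I k J = pm.span (S_gens B X I k J)"

section \<open>Contraction\<close>

text \<open>
  Let \<open>x\<close> be the entry of \<open>X\<close> with index \<open>i\<close>. The space \<open>U / \<KK> x\<close> is identified with the dual of
  \<open>{v \<in> V. x v = 0}\<close>; under this identification, the projection from \<open>U\<close> is restriction of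
  functionals (the lemmas below show that restriction is onto, with kernel \<open>\<KK> x\<close>). The index
  set of \<open>X / x\<close> is \<open>I - {i}\<close>, so that a subsequence of \<open>X\<close> without \<open>x\<close> and its image
  in \<open>X / x\<close> are the same set of indices.
\<close>

definition contr_space :: "'v set \<Rightarrow> ('v \<Rightarrow> 'a::field) \<Rightarrow> 'v set" where
  "contr_space V x = {v\<in>V. x v = 0}"

definition restr :: "'v set \<Rightarrow> ('v \<Rightarrow> 'a::field) \<Rightarrow> ('v \<Rightarrow> 'a)" where
  "restr W u = (\<lambda>v. if v \<in> W then u v else 0)"

definition contr :: "'v set \<Rightarrow> ('i \<Rightarrow> 'v \<Rightarrow> 'a::field) \<Rightarrow> 'i \<Rightarrow> ('i \<Rightarrow> 'v \<Rightarrow> 'a)" where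
  "contr V X i = (\<lambda>j. restr (contr_space V (X i)) (X j))"

definition J_contr :: "'i set set \<Rightarrow> 'i \<Rightarrow> 'i set set" where
  "J_contr J i = {C - {i} | C. C \<in> J \<and> i \<in> C}"

definition J_hat :: "'i set \<Rightarrow> 'i set set \<Rightarrow> 'i \<Rightarrow> 'i set set" where
  "J_hat I J i = {C. C \<in> J \<and> i \<notin> C} \<union> {I - {i}}"

lemma restr_kernel:
  assumes "vector_space scale" "module.subspace scale V"
    and "x \<in> dual_space scale V" "u \<in> dual_space scale V"
  shows "restr (contr_space V x) u = 0 \<longleftrightarrow> u \<in> fn.span {x}"
proof -
  interpret vector_space scale by fact
  have V: "subspace V" by fact
  have x: "\<And>v w. v \<in> V \<Longrightarrow> w \<in> V \<Longrightarrow> x (v + w) = x v + x w"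
      "\<And>c v. v \<in> V \<Longrightarrow> x (scale c v) = c * x v" "\<And>v. v \<notin> V \<Longrightarrow> x v = 0"
    and u: "\<And>v w. v \<in> V \<Longrightarrow> w \<in> V \<Longrightarrow> u (v + w) = u v + u w"
      "\<And>c v. v \<in> V \<Longrightarrow> u (scale c v) = c * u v" "\<And>v. v \<notin> V \<Longrightarrow> u v = 0"
    using assms(3,4) by (auto simp: dual_space_def)
  show ?thesis
  proof
    assume "restr (contr_space V x) u = 0"
    then have ker: "u v = 0" if "v \<in> V" "x v = 0" for v
      using that by (auto simp: restr_def contr_space_def fun_eq_iff split: if_splits)
    show "u \<in> fn.span {x}"
    proof (cases "\<exists>w\<in>V. x w \<noteq> 0")
      case True
      then obtain w where w: "w \<in> V" "x w \<noteq> 0" by blast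
      have "u v = (u w / x w) * x v" for v
      proof (cases "v \<in> V")
        case True
        let ?z = "v + scale (- (x v / x w)) w"
        have mem: "scale (- (x v / x w)) w \<in> V" using w V by (simp add: subspace_neg subspace_scale)
        have "?z \<in> V" using V True mem by (rule subspace_add)
        moreover have "x ?z = 0" using True mem w x by (simp del: scale_minus_left)
        ultimately have "u ?z = 0" by (rule ker)
        then have "u v = (x v / x w) * u w"
          using True mem w u by (simp del: scale_minus_left)
        then show ?thesis by simp
      qed (simp add: x u)
      then have "u = fscale (u w / x w) x" unfolding fscale_def by (rule ext)
      then show ?thesis by (metis fn.span_base fn.span_scale singletonI)
    next
      case False
      then have "u v = 0" for v using ker u(3) by (cases "v \<in> V") auto
      then have "u = 0" by (simp add: fun_eq_iff)
      then show ?thesis by (simp add: fn.span_zero)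
    qed
  next
    assume "u \<in> fn.span {x}"
    then obtain c where "u = fscale c x" by (auto simp: fn.span_singleton)
    then show "restr (contr_space V x) u = 0"
      by (auto simp: restr_def contr_space_def fscale_def fun_eq_iff)
  qed
qed

lemma restr_onto:
  assumes "vector_space scale" "module.subspace scale V" "x \<in> dual_space scale V"
  shows "restr (contr_space V x) ` dual_space scale V = dual_space scale (contr_space V x)"
proof -
  interpret vs: vector_space scale by fact
  interpret vp: vector_space_pair scale "(*) :: 'a \<Rightarrow> 'a \<Rightarrow> 'a"
    by unfold_locales (auto simp: algebra_simps)
  let ?W = "contr_space V x"
  have V: "vs.subspace V" by fact
  have x: "\<And>v w. v \<in> V \<Longrightarrow> w \<in> V \<Longrightarrow> x (v + w) = x v + x w"
      "\<And>c v. v \<in> V \<Longrightarrow> x (scale c v) = c * x v"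
    using assms(3) by (auto simp: dual_space_def)
  have x0: "x 0 = 0" using x(2)[of 0 0] V by (simp add: vs.subspace_0)
  have W: "vs.subspace ?W"
    using V x x0 by (auto simp: vs.subspace_def contr_space_def)
  show ?thesis
  proof
    show "restr ?W ` dual_space scale V \<subseteq> dual_space scale ?W"
      using W by (auto simp: dual_space_def restr_def vs.subspace_def) (auto simp: contr_space_def)
    show "dual_space scale ?W \<subseteq> restr ?W ` dual_space scale V"
    proof
      fix u assume "u \<in> dual_space scale ?W"
      then have u: "\<And>v w. v \<in> ?W \<Longrightarrow> w \<in> ?W \<Longrightarrow> u (v + w) = u v + u w"
        "\<And>c v. v \<in> ?W \<Longrightarrow> u (scale c v) = c * u v" "\<And>v. v \<notin> ?W \<Longrightarrow> u v = 0"
        by (auto simp: dual_space_def)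
      have u0: "u 0 = 0" using u(2)[of 0 0] W by (simp add: vs.subspace_0)
      obtain C where C: "C \<subseteq> ?W" "vs.independent C" "?W \<subseteq> vs.span C"
        using vs.maximal_independent_subset by blast
      have spC: "vs.span C = ?W" using C W vs.span_minimal by blast
      define g where "g = vp.construct C u"
      have g: "Vector_Spaces.linear scale (*) g"
        unfolding g_def using C(2) by (rule vp.linear_construct)
      have "vs.subspace {v \<in> ?W. g v = u v}"
        using g W u0 by (auto simp: vs.subspace_def vp.linear_0 vp.linear_add vp.linear_scale u)
      moreover have "C \<subseteq> {v \<in> ?W. g v = u v}"
        using C(1) vp.construct_basis[OF C(2)] by (auto simp: g_def)
      ultimately have "?W \<subseteq> {v \<in> ?W. g v = u v}"
        using C(3) vs.span_minimal by blast
      then have "u = restr ?W (restr V g)"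
        using u(3) by (auto simp: restr_def fun_eq_iff contr_space_def)
      moreover have "restr V g \<in> dual_space scale V"
        using g V
        by (auto simp: dual_space_def restr_def vp.linear_add vp.linear_scale vs.subspace_add
            vs.subspace_scale)
      ultimately show "u \<in> restr ?W ` dual_space scale V" by blast
    qed
  qed
qed

end

theory Submission
  imports Defs
begin

text \<open>
  Since \<open>x\<close> is a coloop, there is \<open>e \<in> V\<close> with \<open>x(e) = 1\<close> at which all other entries of \<open>X\<close>
  vanish. In a basis of \<open>V\<close> consisting of \<open>e\<close> and a basis of the kernel of \<open>x\<close>, the form
  \<open>p\<^sub>x\<close> is a variable and the other forms do not involve it. Sorting the generators by their
  degree in this variable gives \<open>P(X, k, J) = P(X/x, k, J/x) \<oplus> p\<^sub>x R\<^sub>k\<close> and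
  \<open>R\<^sub>k = Q\<^sub>k \<oplus> p\<^sub>x R\<^bsub>k-1\<^esub>\<close>, where \<open>Q\<^sub>k\<close> is the space of \<open>X/x\<close> for the second upper set;
  for \<open>X - x \<notin> J\<close>, however, \<open>Q\<^sub>0 = 0\<close>. For \<open>k = -1\<close>, the power of \<open>D\<^sub>e\<close> in the ideal is
  \<open>1\<close> or \<open>D\<^sub>e\<close>; in the latter case the kernel does not involve \<open>p\<^sub>x\<close>, and on polynomials
  without \<open>p\<^sub>x\<close> the operators \<open>D\<^bsub>v + c e\<^esub>\<close> and \<open>D\<^sub>v\<close> agree.
\<close>

section \<open>Linear algebra\<close>

text \<open>The bases \<open>B\<close> and \<open>B'\<close> are given independently. Since
  \<open>Hilb\<close> does not depend on the basis, \<open>B\<close> may be exchanged for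
  \<open>insert e B'\<close>; the polynomial ring of X/x then is a subring, with no transport
  needed. The splitting is governed by the indicator. If Y contains x, then \<chi> is taken at a
  subset of X - x, where closures in X and X/x agree because x is a coloop; otherwise it is taken at
  a set containing x, which yields J/x. For Y without x, a cofactor divisible by p_x gives nothing
  new: cancelling p_x lowers the degree bound by one, and \<chi> \<le> 1, so the product reappears
  among the multiples of p_x coming from Y with x. The obstacle is the case that X - x is not in J.
  Then \<chi> vanishes on all subsets of X - x, whereas the second upper set is {X - x}, so the
  indicators differ where the complement of Y spans. For k \<ge> 1 the spaces agree nevertheless, by
  trading a variable for linear forms; for k = 0 one contains 1 and the other is 0, which is why the
  sum stops at k - 1. Characteristic zero enters where D_e f = 0 has to imply that f is free of
  p_x.\<close>

context vector_space
begin

lemma dim_zero_space: "dim {0} = 0"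
  using dim_span_eq_card_independent[OF independent_empty] by simp

text \<open>Coefficients are attached to indices, not to values: \<open>f\<close> may repeat a
  value, as the entries of a sequence may.\<close>

lemma span_image_expand:
  assumes "finite A" "v \<in> span (f ` A)"
  obtains c where "v = (\<Sum>a\<in>A. scale (c a) (f a))"
proof -
  have "\<exists>c. v = (\<Sum>a\<in>A. scale (c a) (f a))"
    using assms
  proof (induction A arbitrary: v)
    case (insert a A)
    then obtain k where "v - scale k (f a) \<in> span (f ` A)"
      by (auto simp: span_insert)
    then obtain c where c: "v - scale k (f a) = (\<Sum>a\<in>A. scale (c a) (f a))"
      using insert.IH by blast
    have "(\<Sum>b\<in>A. scale ((c(a := k)) b) (f b)) = (\<Sum>b\<in>A. scale (c b) (f b))"
      using insert.hyps by (intro sum.cong) auto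
    then have "v = (\<Sum>b\<in>insert a A. scale ((c(a := k)) b) (f b))"
      using insert.hyps c by (simp add: algebra_simps)
    then show ?case by blast
  qed simp
  then show ?thesis using that by blast
qed

text \<open>If an element of \<open>T\<close> depended on \<open>S\<close> and other elements of
  \<open>T\<close>, its component in the span of \<open>S\<close> would lie in both subspaces and
  vanish.\<close>

lemma independent_Un_subspaces:
  assumes "subspace A" "subspace B" "A \<inter> B = {0}"
    and "S \<subseteq> A" "independent S" "finite T" "T \<subseteq> B" "independent T"
  shows "independent (S \<union> T)" "S \<inter> T = {}"
proof -
  show disj: "S \<inter> T = {}"
  proof -
    have "S \<inter> T \<subseteq> A \<inter> B" using assms(4,7) by (rule Int_mono)
    moreover have "0 \<notin> S" using assms(5) dependent_zero by metis
    ultimately show ?thesis unfolding assms(3) by blast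
  qed
  have "independent (S \<union> T)"
    using assms(6-8) disj
  proof (induction T)
    case empty
    then show ?case using assms(5) by simp
  next
    case (insert c C)
    have C: "independent C" using insert.prems independent_mono by blast
    have "c \<notin> span (S \<union> C)"
    proof
      assume "c \<in> span (S \<union> C)"
      then obtain x y where xy: "c = x + y" "x \<in> span S" "y \<in> span C"
        by (auto simp: span_Un)
      have "x \<in> A" using xy(2) span_minimal[OF assms(4,1)] by (rule subsetD[rotated])
      have "y \<in> B" using xy(3) span_minimal[of C B] assms(2) insert.prems(1) by auto
      then have "x \<in> B"
        using xy(1) insert.prems(1) subspace_diff[OF assms(2), of c y] by auto
      with \<open>x \<in> A\<close> assms(3) have "x = 0" by blast
      then have "c \<in> span C" using xy by simp
      then show False using insert.prems(2) insert.hyps by (simp add: independent_insert)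
    qed
    then show ?case
      using insert C by (simp add: independent_insert)
  qed
  then show "independent (S \<union> T)" .
qed

text \<open>An infinite basis would have \<open>card\<close> equal to 0; the finite set
  \<open>F\<close> rules this out for both summands, so that cardinalities add.\<close>

lemma dim_direct_sum:
  assumes A: "subspace A" and B: "subspace B" and "A \<inter> B = {0}"
    and F: "finite F" "A \<subseteq> span F" "B \<subseteq> span F"
  shows "dim {a + b | a b. a \<in> A \<and> b \<in> B} = dim A + dim B"
proof -
  obtain S where S: "S \<subseteq> A" "independent S" "A \<subseteq> span S" "card S = dim A"
    using basis_exists by blast
  obtain T where T: "T \<subseteq> B" "independent T" "B \<subseteq> span T" "card T = dim B"
    using basis_exists by blast
  have fin: "finite S" "finite T"
    using S T F independent_span_bound by (metis order_trans)+
  have "span (S \<union> T) = {a + b | a b. a \<in> A \<and> b \<in> B}"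
    using span_subspace[OF S(1,3) A] span_subspace[OF T(1,3) B] by (simp add: span_Un)
  moreover have "independent (S \<union> T)" "S \<inter> T = {}"
    using independent_Un_subspaces[OF A B assms(3) S(1,2) fin(2) T(1,2)] by auto
  ultimately show ?thesis
    using fin S(4) T(4) by (metis card_Un_disjoint dim_span_eq_card_independent)
qed

end

context vector_space_pair
begin

lemma dim_image_inj_on:
  assumes "Vector_Spaces.linear s1 s2 f" "vs1.subspace S" "inj_on f S"
  shows "vs2.dim (f ` S) = vs1.dim S"
proof -
  obtain T where T: "T \<subseteq> S" "vs1.independent T" "S \<subseteq> vs1.span T" "card T = vs1.dim S"
    using vs1.basis_exists by blast
  have sp: "vs1.span T = S" using T assms(2) vs1.span_subspace by blast
  have "vs2.independent (f ` T)"
    using linear_independent_injective_image[OF assms(1) T(2)] assms(3) sp by simp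
  moreover have "vs2.span (f ` T) = f ` S"
    using linear_span_image[OF assms(1)] sp by simp
  moreover have "card (f ` T) = card T"
    using T(1) assms(3) card_image inj_on_subset by blast
  ultimately show ?thesis using T(4) by (metis vs2.dim_span_eq_card_independent)
qed

end

section \<open>Polynomials\<close>

interpretation pm_pair: vector_space_pair
  "pscale :: 'a::field \<Rightarrow> ('v, 'a) mpoly \<Rightarrow> ('v, 'a) mpoly"
  "pscale :: 'a::field \<Rightarrow> ('w, 'a) mpoly \<Rightarrow> ('w, 'a) mpoly" ..

abbreviation pmono :: "('v \<Rightarrow>\<^sub>0 nat) \<Rightarrow> ('v, 'a::field) mpoly" where
  "pmono m \<equiv> Poly_Mapping.single m 1"

lemma const_0 [simp]: "const 0 = 0"
  by (simp add: const_def)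

lemma single_eq_pscale: "Poly_Mapping.single m c = pscale c (pmono m)"
  by (simp add: pscale_def const_def mult_single)

lemma lookup_pscale [simp]:
  "Poly_Mapping.lookup (pscale c f) m = c * Poly_Mapping.lookup f m"
proof (induction f rule: mpoly_induct)
  case (single n d)
  then show ?case
    by (simp add: pscale_def const_def mult_single lookup_single when_def)
qed (simp add: pm.scale_right_distrib lookup_add algebra_simps)

lemma pscale_mult_left: "pscale c (f * g) = pscale c f * g"
  and pscale_mult_right: "pscale c (f * g) = f * pscale c g"
  by (simp_all add: pscale_def mult_ac)

lemma linear_mult: "Vector_Spaces.linear pscale pscale ((*) (f :: ('v, 'a::field) mpoly))"
  by unfold_locales (simp_all add: ring_distribs pscale_mult_right)

lemma mono_single_Suc: "pmono (m + Poly_Mapping.single b 1) = var b * pmono m"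
  by (simp add: var_def mult_single add.commute)

lemma lookup_var_mult [simp]:
  "Poly_Mapping.lookup (var b * f) (Poly_Mapping.single b 1 + m) = Poly_Mapping.lookup f m"
proof (induction f rule: mpoly_induct)
  case (single n c)
  then show ?case by (simp add: var_def mult_single lookup_single when_def)
qed (simp add: algebra_simps lookup_add)

lemma inj_var_mult: "inj ((*) (var b))"
  by (metis injI lookup_var_mult poly_mapping_eqI)

lemma mdeg_superset:
  assumes "finite A" "Poly_Mapping.keys m \<subseteq> A"
  shows "mdeg m = (\<Sum>b\<in>A. Poly_Mapping.lookup m b)"
  unfolding mdeg_def by (rule sum.mono_neutral_left) (use assms in \<open>auto simp: in_keys_iff\<close>)

lemma mdeg_add [simp]: "mdeg (m + n) = mdeg m + mdeg n"
proof -
  let ?A = "Poly_Mapping.keys m \<union> Poly_Mapping.keys n"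
  have "Poly_Mapping.keys (m + n) \<subseteq> ?A" by (rule keys_add)
  then show ?thesis
    by (simp add: mdeg_superset[of ?A] lookup_add sum.distrib)
qed

lemma mdeg_0 [simp]: "mdeg 0 = 0"
  by (simp add: mdeg_def)

lemma mdeg_single [simp]: "mdeg (Poly_Mapping.single b k) = k"
  by (simp add: mdeg_def)

lemma keys_add_nat: "Poly_Mapping.keys (m + n) = Poly_Mapping.keys m \<union> Poly_Mapping.keys n"
  for m n :: "'v \<Rightarrow>\<^sub>0 nat"
  by (auto simp: in_keys_iff lookup_add)

lemma exponent_split:
  assumes "b \<in> Poly_Mapping.keys m"
  obtains n where "m = n + Poly_Mapping.single b (1::nat)"
proof
  show "m = (m - Poly_Mapping.single b 1) + Poly_Mapping.single b 1"
    using assms by (intro poly_mapping_eqI)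
      (auto simp: lookup_add lookup_minus lookup_single when_def in_keys_iff)
qed

lemma exponent_induct [case_names zero add]:
  fixes m :: "'v \<Rightarrow>\<^sub>0 nat"
  assumes "P 0" "\<And>m b. P m \<Longrightarrow> P (m + Poly_Mapping.single b 1)"
  shows "P m"
proof (induction "mdeg m" arbitrary: m)
  case 0
  then have "m = 0" by (intro poly_mapping_eqI) (auto simp: mdeg_def in_keys_iff)
  then show ?case using assms(1) by simp
next
  case (Suc d)
  then have "m \<noteq> 0" by auto
  then obtain b where "b \<in> Poly_Mapping.keys m"
    by (metis in_keys_iff lookup_zero poly_mapping_eqI)
  then obtain n where "m = n + Poly_Mapping.single b 1" by (rule exponent_split)
  then show ?case using Suc assms(2)[of n b] by simp
qed

lemma subspace_sym_alg: "pm.subspace (sym_alg B :: ('v, 'a::field) mpoly set)"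
proof (rule pm.subspaceI)
  fix f g :: "('v, 'a) mpoly"
  assume "f \<in> sym_alg B" "g \<in> sym_alg B"
  then show "f + g \<in> sym_alg B"
    using keys_add[of f g] unfolding sym_alg_def by blast
qed (auto simp: sym_alg_def in_keys_iff)

lemma sym_alg_mult: "f \<in> sym_alg B \<Longrightarrow> g \<in> sym_alg B \<Longrightarrow> f * g \<in> sym_alg B"
  using keys_mult[of f g] by (fastforce simp: sym_alg_def keys_add_nat)

lemma single_in_sym_alg: "Poly_Mapping.keys m \<subseteq> B \<Longrightarrow> Poly_Mapping.single m c \<in> sym_alg B"
  by (simp add: sym_alg_def)

lemma const_in_sym_alg: "const c \<in> sym_alg B"
  by (simp add: const_def single_in_sym_alg)

lemma one_in_sym_alg: "1 \<in> sym_alg B"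
  using const_in_sym_alg[of 1] by simp

lemma var_in_sym_alg: "b \<in> B \<Longrightarrow> var b \<in> sym_alg B"
  by (simp add: var_def single_in_sym_alg)

lemma sym_alg_prod: "(\<And>j. j \<in> A \<Longrightarrow> f j \<in> sym_alg B) \<Longrightarrow> (\<Prod>j\<in>A. f j) \<in> sym_alg B"
  by (induction A rule: infinite_finite_induct) (auto intro: one_in_sym_alg sym_alg_mult)

lemma sym_alg_mono: "B \<subseteq> C \<Longrightarrow> sym_alg B \<subseteq> sym_alg C"
  by (auto simp: sym_alg_def)

lemma p_elt_in_sym_alg: "p_elt B u \<in> sym_alg B"
  unfolding p_elt_def
  by (intro pm.subspace_sum[OF subspace_sym_alg] pm.subspace_scale[OF subspace_sym_alg]
      var_in_sym_alg)

lemma p_prod_in_sym_alg: "p_prod B X Y \<in> sym_alg B"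
  unfolding p_prod_def by (intro sym_alg_prod p_elt_in_sym_alg)

text \<open>Reduces identities between algebra maps and derivations to constants and
  variables.\<close>

lemma sym_alg_induct [consumes 1, case_names const var add mult]:
  assumes "f \<in> sym_alg B"
    and "\<And>c. P (const c)" "\<And>b. b \<in> B \<Longrightarrow> P (var b)"
    and "\<And>f g. f \<in> sym_alg B \<Longrightarrow> g \<in> sym_alg B \<Longrightarrow> P f \<Longrightarrow> P g \<Longrightarrow> P (f + g)"
    and "\<And>f g. f \<in> sym_alg B \<Longrightarrow> g \<in> sym_alg B \<Longrightarrow> P f \<Longrightarrow> P g \<Longrightarrow> P (f * g)"
  shows "P f"
proof -
  have mono: "Poly_Mapping.keys m \<subseteq> B \<Longrightarrow> P (pmono m)" for m
  proof (induction m rule: exponent_induct)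
    case zero
    then show ?case using assms(2)[of 1] by simp
  next
    case (add m b)
    then have "b \<in> B" "Poly_Mapping.keys m \<subseteq> B" by (auto simp: keys_add_nat)
    then show ?case
      unfolding mono_single_Suc
      by (intro assms(5) var_in_sym_alg single_in_sym_alg assms(3) add.IH)
  qed
  have single: "P (Poly_Mapping.single m c)" if "Poly_Mapping.keys m \<subseteq> B" for m c
  proof -
    have "P (const c * pmono m)"
      by (intro assms(5) mono assms(2) const_in_sym_alg single_in_sym_alg that)
    then show ?thesis by (simp add: const_def mult_single)
  qed
  have "M \<subseteq> Poly_Mapping.keys f \<Longrightarrow>
      P (\<Sum>m\<in>M. Poly_Mapping.single m (Poly_Mapping.lookup f m))" if "finite M" for M
    using that
  proof (induction M)
    case empty
    then show ?case using assms(2)[of 0] by simp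
  next
    case (insert m M)
    have "(\<Sum>m\<in>M. Poly_Mapping.single m (Poly_Mapping.lookup f m)) \<in> sym_alg B"
      using insert.prems assms(1)
      by (intro pm.subspace_sum[OF subspace_sym_alg] single_in_sym_alg) (auto simp: sym_alg_def)
    moreover have "Poly_Mapping.keys m \<subseteq> B"
      using insert.prems assms(1) by (auto simp: sym_alg_def)
    ultimately show ?case
      using insert by (simp add: assms(4) single single_in_sym_alg)
  qed
  then show ?thesis by (metis finite_keys mpoly_sum_single order_refl)
qed

lemma subspace_homogeneous: "pm.subspace (homogeneous d :: ('v, 'a::field) mpoly set)"
proof (rule pm.subspaceI)
  fix f g :: "('v, 'a) mpoly"
  assume "f \<in> homogeneous d" "g \<in> homogeneous d"
  then show "f + g \<in> homogeneous d"
    using keys_add[of f g] unfolding homogeneous_def by blast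
qed (auto simp: homogeneous_def in_keys_iff)

lemma homogeneous_mult:
  "f \<in> homogeneous c \<Longrightarrow> g \<in> homogeneous d \<Longrightarrow> f * g \<in> homogeneous (c + d)"
  using keys_mult[of f g] by (fastforce simp: homogeneous_def)

lemma mono_homogeneous: "pmono m \<in> homogeneous (mdeg m)"
  by (simp add: homogeneous_def)

lemma var_homogeneous: "var b \<in> homogeneous 1"
  by (simp add: homogeneous_def var_def)

lemma p_elt_homogeneous: "p_elt B u \<in> homogeneous 1"
  unfolding p_elt_def
  by (intro pm.subspace_sum[OF subspace_homogeneous] pm.subspace_scale[OF subspace_homogeneous]
      var_homogeneous)

lemma p_prod_homogeneous: "p_prod B X Y \<in> homogeneous (card Y)"
proof (induction Y rule: infinite_finite_induct)
  case (insert j Y)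
  then show ?case
    using homogeneous_mult[OF p_elt_homogeneous[of B "X j"], of "p_prod B X Y"]
    by (simp add: p_prod_def)
qed (simp_all add: p_prod_def homogeneous_def)

lemma finite_exponents:
  assumes "finite B"
  shows "finite {m. Poly_Mapping.keys m \<subseteq> B \<and> mdeg m = d}"
proof (rule finite_imageD)
  let ?F = "{f. \<forall>b. (b \<in> B \<longrightarrow> f b \<in> {..d}) \<and> (b \<notin> B \<longrightarrow> f b = 0)}"
  have "Poly_Mapping.lookup m b \<le> d" if "Poly_Mapping.keys m \<subseteq> B" "mdeg m = d" "b \<in> B" for m b
    using that mdeg_superset[OF assms that(1)] member_le_sum[OF that(3) _ assms] by auto
  then have "Poly_Mapping.lookup ` {m. Poly_Mapping.keys m \<subseteq> B \<and> mdeg m = d} \<subseteq> ?F"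
    by (auto simp: in_keys_iff subset_iff)
  then show "finite (Poly_Mapping.lookup ` {m. Poly_Mapping.keys m \<subseteq> B \<and> mdeg m = d})"
    using finite_set_of_finite_funs[OF assms, of "{..d}" 0] finite_subset by blast
qed (simp add: inj_on_def)

lemma sym_alg_homogeneous_finite_span:
  assumes "finite B"
  obtains F :: "('v, 'a::field) mpoly set"
  where "finite F" "sym_alg B \<inter> homogeneous d \<subseteq> pm.span F"
proof -
  let ?M = "{m. Poly_Mapping.keys m \<subseteq> B \<and> mdeg m = d}"
  have "f \<in> pm.span (pmono ` ?M)" if f: "f \<in> sym_alg B \<inter> homogeneous d" for f :: "('v, 'a) mpoly"
  proof -
    have "(\<Sum>m\<in>Poly_Mapping.keys f. pscale (Poly_Mapping.lookup f m) (pmono m))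
        \<in> pm.span (pmono ` ?M)"
      using f by (intro pm.span_sum pm.span_scale pm.span_base imageI)
        (auto simp: sym_alg_def homogeneous_def)
    then show ?thesis
      using mpoly_sum_single[of f] by (simp add: single_eq_pscale[symmetric])
  qed
  then show ?thesis
    using that[of "pmono ` ?M"] finite_exponents[OF assms] by blast
qed

subsection \<open>Graded subspaces\<close>

definition hcomp :: "nat \<Rightarrow> ('v, 'a::field) mpoly \<Rightarrow> ('v, 'a) mpoly" where
  "hcomp d f = Poly_Mapping.mapp (\<lambda>m c. c when mdeg m = d) f"

lemma lookup_hcomp: "Poly_Mapping.lookup (hcomp d f) m = (Poly_Mapping.lookup f m when mdeg m = d)"
  by (auto simp: hcomp_def lookup_mapp when_def in_keys_iff)

lemma hcomp_homogeneous: "hcomp d f \<in> homogeneous d"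
  by (auto simp: homogeneous_def in_keys_iff lookup_hcomp)

lemma hcomp_add: "hcomp d (f + g) = hcomp d f + hcomp d g"
  by (rule poly_mapping_eqI) (simp add: lookup_hcomp lookup_add when_def)

lemma hcomp_pscale: "hcomp d (pscale c f) = pscale c (hcomp d f)"
  by (rule poly_mapping_eqI) (simp add: lookup_hcomp when_def)

lemma hcomp_of_homogeneous:
  assumes "f \<in> homogeneous c"
  shows "hcomp d f = (if c = d then f else 0)"
  by (rule poly_mapping_eqI)
     (use assms in \<open>auto simp: lookup_hcomp when_def homogeneous_def in_keys_iff\<close>)

lemma single_homogeneous: "Poly_Mapping.single m c \<in> homogeneous (mdeg m)"
  by (simp add: homogeneous_def)

lemma var_mult_single_homogeneous:
  "var b * Poly_Mapping.single m c \<in> homogeneous (Suc (mdeg m))"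
  using homogeneous_mult[OF var_homogeneous single_homogeneous, of b m c] by simp

lemma hcomp_var_mult: "hcomp (Suc d) (var b * f) = var b * hcomp d f"
proof (induction f rule: mpoly_induct)
  case (single n c)
  show ?case
    by (simp add: hcomp_of_homogeneous[OF single_homogeneous]
        hcomp_of_homogeneous[OF var_mult_single_homogeneous])
qed (simp add: hcomp_add ring_distribs)

lemma hcomp_0_var_mult: "hcomp 0 (var b * f) = 0"
proof (induction f rule: mpoly_induct)
  case (single n c)
  show ?case
    by (simp add: hcomp_of_homogeneous[OF var_mult_single_homogeneous])
qed (simp add: hcomp_add ring_distribs)

text \<open>Closure under the projections \<open>hcomp\<close> makes passing to degree
  \<open>d\<close> parts, as \<open>Hilb\<close> does, compatible with sums of subspaces.\<close>

definition graded :: "('v, 'a::field) mpoly set \<Rightarrow> bool" where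
  "graded W \<longleftrightarrow> pm.subspace W \<and> (\<forall>f\<in>W. \<forall>d. hcomp d f \<in> W)"

lemma graded_span:
  fixes S :: "('v, 'a::field) mpoly set"
  assumes "\<And>f. f \<in> S \<Longrightarrow> \<exists>d. f \<in> homogeneous d"
  shows "graded (pm.span S)"
proof -
  have "hcomp d f \<in> pm.span S" if "f \<in> pm.span S" for f d
    using that
  proof (induction rule: pm.span_induct_alt)
    case base
    have "hcomp d (0 :: ('v, 'a) mpoly) = 0" by (rule poly_mapping_eqI) (simp add: lookup_hcomp)
    then show ?case by (simp add: pm.span_zero)
  next
    case (step c f g)
    obtain d' where d': "f \<in> homogeneous d'" using assms[OF step(1)] ..
    have "hcomp d f \<in> pm.span S"
      using step(1) by (simp add: hcomp_of_homogeneous[OF d'] pm.span_base pm.span_zero)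
    then show ?case
      using step by (simp add: hcomp_add hcomp_pscale pm.span_add pm.span_scale)
  qed
  then show ?thesis by (simp add: graded_def)
qed

lemma Hilb_zero_space: "Hilb {0 :: ('v, 'a::field) mpoly} = 0"
proof -
  have "{0} \<inter> homogeneous d = ({0} :: ('v, 'a) mpoly set)" for d
    by (auto simp: homogeneous_def)
  then show ?thesis by (simp add: Hilb_def fps_eq_iff pm.dim_zero_space)
qed

text \<open>The sum is direct: a nonzero multiple of \<open>var e\<close> involves \<open>e\<close>,
  which no element of \<open>W\<close> does. Multiplication by \<open>var e\<close> is injective and
  raises degrees by one, hence the factor \<open>fps_X\<close>.\<close>

lemma Hilb_add_var_mult:
  fixes W R :: "('v, 'a::field) mpoly set"
  assumes B: "finite B" "e \<notin> B"
    and W: "graded W" "W \<subseteq> sym_alg B" and R: "graded R" "R \<subseteq> sym_alg (insert e B)"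
  shows "Hilb {f + var e * g | f g. f \<in> W \<and> g \<in> R} = Hilb W + fps_X * Hilb R"
proof (rule fps_ext)
  fix d
  let ?S = "{f + var e * g | f g. f \<in> W \<and> g \<in> R}"
  let ?x = "(*) (var e)"
  have sub: "pm.subspace W" "pm.subspace R" using W(1) R(1) by (simp_all add: graded_def)
  have comp: "hcomp c f \<in> W" "hcomp c g \<in> R" if "f \<in> W" "g \<in> R" for c f g
    using that W(1) R(1) by (simp_all add: graded_def)
  \<comment> \<open>The degree \<open>d\<close> part of the multiples of \<open>var e\<close>; in
    degree 0 there are none but 0.\<close>
  define R' where "R' = (case d of 0 \<Rightarrow> {0} | Suc c \<Rightarrow> ?x ` (R \<inter> homogeneous c))"
  have subR': "pm.subspace R'"
  proof (cases d)
    case (Suc c)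
    have "pm.subspace (?x ` (R \<inter> homogeneous c))"
      by (rule pm_pair.linear_subspace_image[OF linear_mult
            pm.subspace_inter[OF sub(2) subspace_homogeneous]])
    then show ?thesis by (simp add: R'_def Suc)
  qed (simp add: R'_def)
  have x_sym: "?x g \<in> sym_alg (insert e B)" if "g \<in> R" for g
    using that R(2) by (auto intro!: sym_alg_mult var_in_sym_alg)
  have x_hom: "?x g \<in> homogeneous (Suc c)" if "g \<in> homogeneous c" for g c
    using homogeneous_mult[OF var_homogeneous that, of e] by simp
  have R'_sub: "R' \<subseteq> sym_alg (insert e B) \<inter> homogeneous d"
    using x_sym x_hom
    by (auto simp: R'_def pm.subspace_0[OF subspace_sym_alg] pm.subspace_0[OF subspace_homogeneous]
        split: nat.split)
  have R'_R: "\<exists>g\<in>R. h = ?x g" if "h \<in> R'" for h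
    using that pm.subspace_0[OF sub(2)] by (auto simp: R'_def split: nat.splits intro: bexI[of _ 0])
  have eq: "?S \<inter> homogeneous d = {f + h | f h. f \<in> W \<inter> homogeneous d \<and> h \<in> R'}"
  proof (intro equalityI subsetI)
    fix s assume "s \<in> ?S \<inter> homogeneous d"
    then obtain f g where fg: "s = f + ?x g" "f \<in> W" "g \<in> R" "s \<in> homogeneous d" by blast
    have "hcomp d s = s" using fg(4) by (simp add: hcomp_of_homogeneous)
    then have "s = hcomp d f + hcomp d (?x g)" using fg(1) by (simp add: hcomp_add)
    moreover have "hcomp d f \<in> W \<inter> homogeneous d"
      using fg(2,3) by (simp add: comp hcomp_homogeneous)
    moreover have "hcomp d (?x g) \<in> R'"
      using comp(2)[OF fg(2,3)]
      by (auto simp: R'_def hcomp_homogeneous hcomp_0_var_mult hcomp_var_mult split: nat.split)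
    ultimately show "s \<in> {f + h | f h. f \<in> W \<inter> homogeneous d \<and> h \<in> R'}" by blast
  next
    fix s assume "s \<in> {f + h | f h. f \<in> W \<inter> homogeneous d \<and> h \<in> R'}"
    then obtain f h where fh: "s = f + h" "f \<in> W" "f \<in> homogeneous d" "h \<in> R'" by blast
    then show "s \<in> ?S \<inter> homogeneous d"
      using R'_R[OF fh(4)] R'_sub pm.subspace_add[OF subspace_homogeneous, of f d h] by blast
  qed
  have disj: "(W \<inter> homogeneous d) \<inter> R' = {0}"
  proof -
    have "h = 0" if hW: "h \<in> W" and hR: "h \<in> R'" for h
    proof -
      obtain g where g: "h = ?x g" using R'_R[OF hR] by blast
      have "Poly_Mapping.lookup g m = 0" for m
      proof (rule ccontr)
        let ?n = "Poly_Mapping.single e 1 + m"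
        assume "Poly_Mapping.lookup g m \<noteq> 0"
        then have "Poly_Mapping.lookup h ?n \<noteq> 0"
          unfolding g lookup_var_mult .
        then have "?n \<in> Poly_Mapping.keys h"
          by (rule in_keys_iff[THEN iffD2])
        moreover have "h \<in> sym_alg B" using hW W(2) by (rule subsetD[rotated])
        ultimately have "Poly_Mapping.keys ?n \<subseteq> B"
          unfolding sym_alg_def by blast
        then show False using B(2) by (simp add: keys_add_nat)
      qed
      then have "g = 0" by (intro poly_mapping_eqI) simp
      then show ?thesis using g by simp
    qed
    moreover have "0 \<in> (W \<inter> homogeneous d) \<inter> R'"
      by (intro IntI pm.subspace_0 sub(1) subR' subspace_homogeneous)
    ultimately show ?thesis by blast
  qed
  \<comment> \<open>The degree \<open>d\<close> part of the whole polynomial ring is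
    finite-dimensional, as \<open>dim_direct_sum\<close> requires.\<close>
  obtain F :: "('v, 'a) mpoly set" where F: "finite F" "sym_alg (insert e B) \<inter> homogeneous d \<subseteq> pm.span F"
    using sym_alg_homogeneous_finite_span[of "insert e B" d] B(1) by blast
  have "W \<inter> homogeneous d \<subseteq> pm.span F"
    using W(2) sym_alg_mono[of B "insert e B"] F(2) by blast
  moreover have "R' \<subseteq> pm.span F" using R'_sub F(2) by blast
  ultimately have "pm.dim (?S \<inter> homogeneous d) = pm.dim (W \<inter> homogeneous d) + pm.dim R'"
    unfolding eq
    by (rule pm.dim_direct_sum[OF pm.subspace_inter[OF sub(1) subspace_homogeneous] subR' disj F(1)])
  moreover have "pm.dim R' = (case d of 0 \<Rightarrow> 0 | Suc c \<Rightarrow> pm.dim (R \<inter> homogeneous c))"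
  proof (cases d)
    case 0
    then show ?thesis by (simp add: R'_def pm.dim_zero_space)
  next
    case (Suc c)
    have "pm.dim (?x ` (R \<inter> homogeneous c)) = pm.dim (R \<inter> homogeneous c)"
      by (rule pm_pair.dim_image_inj_on[OF linear_mult
            pm.subspace_inter[OF sub(2) subspace_homogeneous] inj_on_subset[OF inj_var_mult]]) simp
    then show ?thesis using Suc by (simp add: R'_def)
  qed
  ultimately show "fps_nth (Hilb ?S) d = fps_nth (Hilb W + fps_X * Hilb R) d"
    by (simp add: Hilb_def split: nat.split)
qed

subsection \<open>Substitution\<close>

definition psubst :: "('v \<Rightarrow> ('w, 'a::field) mpoly) \<Rightarrow> ('v, 'a) mpoly \<Rightarrow> ('w, 'a) mpoly" where
  "psubst s f = (\<Sum>m\<in>Poly_Mapping.keys f. pscale (Poly_Mapping.lookup f m)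
      (\<Prod>b\<in>Poly_Mapping.keys m. s b ^ Poly_Mapping.lookup m b))"

lemma psubst_superset:
  assumes "finite A" "Poly_Mapping.keys f \<subseteq> A"
  shows "psubst s f = (\<Sum>m\<in>A. pscale (Poly_Mapping.lookup f m)
      (\<Prod>b\<in>Poly_Mapping.keys m. s b ^ Poly_Mapping.lookup m b))"
  unfolding psubst_def
  by (rule sum.mono_neutral_left) (use assms in \<open>auto simp: in_keys_iff\<close>)

lemma psubst_add: "psubst s (f + g) = psubst s f + psubst s g"
proof -
  let ?A = "Poly_Mapping.keys f \<union> Poly_Mapping.keys g"
  have "Poly_Mapping.keys (f + g) \<subseteq> ?A" by (rule keys_add)
  then show ?thesis
    by (simp add: psubst_superset[of ?A] lookup_add pm.scale_left_distrib sum.distrib)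
qed

lemma psubst_single: "psubst s (Poly_Mapping.single m c)
    = pscale c (\<Prod>b\<in>Poly_Mapping.keys m. s b ^ Poly_Mapping.lookup m b)"
  by (subst psubst_superset[of "{m}"]) auto

lemma psubst_mult: "psubst s (f * g) = psubst s f * psubst s g"
proof (induction f rule: mpoly_induct)
  case (single m c)
  show ?case
  proof (induction g rule: mpoly_induct)
    case (single n d)
    let ?A = "Poly_Mapping.keys m \<union> Poly_Mapping.keys n"
    have superset: "(\<Prod>b\<in>Poly_Mapping.keys k. s b ^ Poly_Mapping.lookup k b)
        = (\<Prod>b\<in>?A. s b ^ Poly_Mapping.lookup k b)" if "Poly_Mapping.keys k \<subseteq> ?A" for k
      by (rule prod.mono_neutral_left) (use that in \<open>auto simp: in_keys_iff\<close>)
    have "(\<Prod>b\<in>Poly_Mapping.keys (m + n). s b ^ Poly_Mapping.lookup (m + n) b)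
        = (\<Prod>b\<in>Poly_Mapping.keys m. s b ^ Poly_Mapping.lookup m b)
        * (\<Prod>b\<in>Poly_Mapping.keys n. s b ^ Poly_Mapping.lookup n b)"
      by (simp add: superset[of "m + n"] superset[of m] superset[of n] keys_add_nat lookup_add
          power_add prod.distrib)
    then show ?case
      by (simp add: mult_single psubst_single pscale_def const_mult mult_ac)
  qed (simp add: psubst_add ring_distribs)
qed (simp add: psubst_add ring_distribs)

lemma psubst_const: "psubst s (const c) = const c"
  by (simp add: const_def psubst_single) (simp add: pscale_def const_def)

lemma psubst_1 [simp]: "psubst s 1 = 1"
  using psubst_const[of s 1] by simp

lemma psubst_0 [simp]: "psubst s 0 = 0"
  by (simp add: psubst_def)

lemma psubst_var: "psubst s (var b) = s b"
  by (simp add: var_def psubst_single)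

lemma psubst_pscale: "psubst s (pscale c f) = pscale c (psubst s f)"
  by (simp add: pscale_def psubst_mult psubst_const)

lemma psubst_sum: "psubst s (\<Sum>j\<in>A. f j) = (\<Sum>j\<in>A. psubst s (f j))"
  by (induction A rule: infinite_finite_induct) (simp_all add: psubst_add)

lemma psubst_prod: "psubst s (\<Prod>j\<in>A. f j) = (\<Prod>j\<in>A. psubst s (f j))"
  by (induction A rule: infinite_finite_induct) (simp_all add: psubst_mult)

lemma linear_psubst: "Vector_Spaces.linear pscale pscale (psubst s)"
  by unfold_locales (simp_all add: psubst_add psubst_pscale)

lemma psubst_in_sym_alg:
  assumes "f \<in> sym_alg B" "\<And>b. b \<in> B \<Longrightarrow> s b \<in> sym_alg C"
  shows "psubst s f \<in> sym_alg C"
  using assms(1)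
  by (induction f rule: sym_alg_induct)
     (auto simp: psubst_const psubst_var psubst_add psubst_mult assms(2)
       intro: const_in_sym_alg sym_alg_mult pm.subspace_add[OF subspace_sym_alg])

lemma psubst_mono_homogeneous:
  assumes "\<And>b. s b \<in> homogeneous 1"
  shows "psubst s (pmono m) \<in> homogeneous (mdeg m)"
proof (induction m rule: exponent_induct)
  case zero
  then show ?case by (simp add: homogeneous_def)
next
  case (add m b)
  have "psubst s (pmono (m + Poly_Mapping.single b 1)) = s b * psubst s (pmono m)"
    by (simp only: mono_single_Suc psubst_mult psubst_var)
  then show ?case
    using homogeneous_mult[OF assms add.IH, of b] by simp
qed

lemma psubst_homogeneous:
  assumes "\<And>b. s b \<in> homogeneous 1" "f \<in> homogeneous d"
  shows "psubst s f \<in> homogeneous d"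
proof -
  have "psubst s f = (\<Sum>m\<in>Poly_Mapping.keys f. pscale (Poly_Mapping.lookup f m) (psubst s (pmono m)))"
    by (simp add: psubst_def psubst_single)
  also have "\<dots> \<in> homogeneous d"
  proof (intro pm.subspace_sum[OF subspace_homogeneous] pm.subspace_scale[OF subspace_homogeneous])
    fix m assume "m \<in> Poly_Mapping.keys f"
    then have "mdeg m = d" using assms(2) by (simp add: homogeneous_def)
    then show "psubst s (pmono m) \<in> homogeneous d"
      using psubst_mono_homogeneous[of s m, OF assms(1)] by simp
  qed
  finally show ?thesis .
qed

subsection \<open>The action\<close>

lemma sym_act_pscale: "sym_act q (pscale c f) = pscale c (sym_act q f)"
proof (induction q rule: mpoly_induct)
  case (single m a)
  show ?case
  proof (induction f rule: mpoly_induct)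
    case (single n d)
    then show ?case by (simp add: pscale_def const_def mult_single sym_act_single mult_ac)
  qed (simp add: sym_act_add_right pm.scale_right_distrib)
qed (simp add: sym_act_add_left pm.scale_right_distrib)

lemma sym_act_D_elt_const: "sym_act (D_elt scale B v) (const c) = 0"
proof -
  \<comment> \<open>The Leibniz rule for the product 1 * 1.\<close>
  have "sym_act (D_elt scale B v) 1 = sym_act (D_elt scale B v) 1 + sym_act (D_elt scale B v) 1"
    using sym_act_D_elt_mult[of scale B v 1 1] by simp
  then have "sym_act (D_elt scale B v) 1 = 0" by simp
  then show ?thesis
    using sym_act_pscale[of "D_elt scale B v" c 1] by (simp add: pscale_def)
qed

lemma sym_act_in_sym_alg:
  assumes "f \<in> sym_alg B"
  shows "sym_act q f \<in> sym_alg B"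
  unfolding sym_act_def
proof (intro pm.subspace_sum[OF subspace_sym_alg] single_in_sym_alg)
  fix m n assume "n \<in> Poly_Mapping.keys f"
  then have "Poly_Mapping.keys n \<subseteq> B" using assms by (auto simp: sym_alg_def)
  moreover have "Poly_Mapping.keys (n - m) \<subseteq> Poly_Mapping.keys n"
    by (auto simp: in_keys_iff lookup_minus)
  ultimately show "Poly_Mapping.keys (n - m) \<subseteq> B" by blast
qed

text \<open>Annihilation passes from the generators to the ideal because \<open>sym_act\<close> is
  additive in its first argument and turns products into compositions.\<close>

lemma ker_sym_ideal: "ker B (sym_ideal B G) = {f \<in> sym_alg B. \<forall>g\<in>G. sym_act g f = 0}"
proof -
  have "g \<in> sym_ideal B G" if "g \<in> G" for g
    unfolding sym_ideal_def
    by (rule CollectI, rule exI[of _ "{g}"], rule exI[of _ "\<lambda>_. 1"])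
      (use that in \<open>simp add: one_in_sym_alg\<close>)
  moreover have "sym_act q f = 0" if "\<forall>g\<in>G. sym_act g f = 0" "q \<in> sym_ideal B G" for f q
    using that by (auto simp: sym_ideal_def sym_act_sum_left sym_act_mult subset_iff
        intro!: sum.neutral)
  ultimately show ?thesis by (auto simp: ker_def)
qed

lemma ker_power_ideal:
  "ker B (power_ideal scale B X I k J) = {f \<in> sym_alg B. \<forall>\<eta>\<in>module.span scale B - {0}.
     sym_act (D_elt scale B \<eta> ^ nat (int (card (I - flat_of X I \<eta>)) + k
       + int (chi X I J (flat_of X I \<eta>)))) f = 0}"
  unfolding power_ideal_def ker_sym_ideal by auto

lemma subspace_ker: "pm.subspace (ker B \<I>)"
  unfolding ker_def
  by (rule pm.subspaceI)
     (auto simp: sym_act_add_right sym_act_pscale pm.subspace_0[OF subspace_sym_alg]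
       intro: pm.subspace_add[OF subspace_sym_alg] pm.subspace_scale[OF subspace_sym_alg])

subsection \<open>Spaces spanned by multiples of the products\<close>

text \<open>With the strict bound \<open>mdeg m < c Y\<close>, the choice \<open>c Y = \<chi>(X - Y) + k\<close> describes the
  generators of \<open>P(X, k, J)\<close> for \<open>k = 0\<close> and \<open>k \<ge> 1\<close> alike, without truncated subtraction.\<close>

definition gspace ::
    "'v set \<Rightarrow> ('i \<Rightarrow> 'v \<Rightarrow> 'a::field) \<Rightarrow> 'i set \<Rightarrow> ('i set \<Rightarrow> nat) \<Rightarrow> ('v, 'a) mpoly set" where
  "gspace B X I c = pm.span {pmono m * p_prod B X Y | m Y.
     Y \<subseteq> I \<and> Poly_Mapping.keys m \<subseteq> B \<and> mdeg m < c Y}"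

lemma subspace_gspace: "pm.subspace (gspace B X I c)"
  by (simp add: gspace_def)

lemma mono_mult_in_gspace:
  "Y \<subseteq> I \<Longrightarrow> Poly_Mapping.keys m \<subseteq> B \<Longrightarrow> mdeg m < c Y \<Longrightarrow> pmono m * p_prod B X Y \<in> gspace B X I c"
  unfolding gspace_def by (rule pm.span_base) blast

lemma mult_in_gspace:
  assumes "Y \<subseteq> I" "f \<in> sym_alg B" "deg_le f d" "d < c Y"
  shows "f * p_prod B X Y \<in> gspace B X I c"
proof -
  have "f * p_prod B X Y = (\<Sum>m\<in>Poly_Mapping.keys f.
      pscale (Poly_Mapping.lookup f m) (pmono m * p_prod B X Y))"
    using mpoly_sum_single[of f]
    by (metis (no_types, lifting) pscale_mult_left single_eq_pscale sum.cong sum_distrib_right)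
  also have "\<dots> \<in> gspace B X I c"
    using assms
    by (intro pm.subspace_sum[OF subspace_gspace] pm.subspace_scale[OF subspace_gspace]
        mono_mult_in_gspace) (fastforce simp: sym_alg_def deg_le_def)+
  finally show ?thesis .
qed

lemma gspace_minimal:
  assumes "pm.subspace W"
    and "\<And>m Y. Y \<subseteq> I \<Longrightarrow> Poly_Mapping.keys m \<subseteq> B \<Longrightarrow> mdeg m < c Y \<Longrightarrow> pmono m * p_prod B X Y \<in> W"
  shows "gspace B X I c \<subseteq> W"
  unfolding gspace_def by (rule pm.span_minimal) (use assms in auto)

lemma gspace_mono:
  assumes "\<And>Y. Y \<subseteq> I \<Longrightarrow> c Y \<le> d Y"
  shows "gspace B X I c \<subseteq> gspace B X I d"
  by (intro gspace_minimal subspace_gspace mono_mult_in_gspace)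
     (use assms in \<open>auto intro: less_le_trans\<close>)

lemma gspace_cong:
  assumes "\<And>Y. Y \<subseteq> I \<Longrightarrow> c Y = d Y"
  shows "gspace B X I c = gspace B X I d"
  using assms by (intro equalityI gspace_mono) auto

lemma gspace_zero:
  assumes "\<And>Y. Y \<subseteq> I \<Longrightarrow> c Y = 0"
  shows "gspace B X I c = {0}"
proof -
  have "gspace B X I c \<subseteq> {0}" by (rule gspace_minimal) (use assms in auto)
  then show ?thesis using pm.subspace_0[OF subspace_gspace] by blast
qed

lemma gspace_sub_sym_alg: "gspace B X I c \<subseteq> sym_alg B"
  by (intro gspace_minimal subspace_sym_alg sym_alg_mult single_in_sym_alg p_prod_in_sym_alg)

lemma graded_gspace: "graded (gspace B X I c)"
  unfolding gspace_def
  by (rule graded_span) (auto intro: homogeneous_mult mono_homogeneous p_prod_homogeneous)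

text \<open>For \<open>k = 0\<close> the bound \<open>mdeg m < \<chi>\<close> leaves only
  \<open>m = 0\<close> with \<chi> = 1, that is, the bare product. For positive \<open>k\<close> the
  strict bound is the non-strict one shifted by one, and a general cofactor is a combination of
  monomials.\<close>

lemma P_space_eq_gspace:
  fixes X :: "'i \<Rightarrow> 'v \<Rightarrow> 'a::field"
  shows "P_space B X I k J = gspace B X I (\<lambda>Y. chi X I J (I - Y) + k)"
proof
  show "P_space B X I k J \<subseteq> gspace B X I (\<lambda>Y. chi X I J (I - Y) + k)"
    unfolding P_space_def
  proof (rule pm.span_minimal[OF _ subspace_gspace], rule subsetI)
    fix s assume s: "s \<in> S_gens B X I k J"
    show "s \<in> gspace B X I (\<lambda>Y. chi X I J (I - Y) + k)"
    proof (cases "k = 0")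
      case True
      then obtain Y where "s = pmono 0 * p_prod B X Y" "Y \<subseteq> I" "clos X I (I - Y) \<in> J"
        using s by (auto simp: S_gens_def)
      then show ?thesis by (auto simp: chi_def simp del: single_one intro!: mono_mult_in_gspace)
    next
      case False
      then obtain f Y where "s = f * p_prod B X Y" "Y \<subseteq> I" "f \<in> sym_alg B"
          "deg_le f (chi X I J (I - Y) + k - 1)"
        using s by (auto simp: S_gens_def)
      then show ?thesis using False by (auto intro!: mult_in_gspace)
    qed
  qed
  show "gspace B X I (\<lambda>Y. chi X I J (I - Y) + k) \<subseteq> P_space B X I k J"
  proof (rule gspace_minimal)
    fix m Y assume Y: "Y \<subseteq> I" "Poly_Mapping.keys m \<subseteq> B" "mdeg m < chi X I J (I - Y) + k"
    have "pmono m * p_prod B X Y \<in> S_gens B X I k J"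
    proof (cases "k = 0")
      case True
      then have "mdeg m = 0" and J: "clos X I (I - Y) \<in> J"
        using Y(3) by (auto simp: chi_def split: if_splits)
      then have "m = 0"
        by (intro poly_mapping_eqI) (auto simp: mdeg_def in_keys_iff)
      then show ?thesis using Y J True by (auto simp: S_gens_def)
    next
      case False
      have "deg_le (pmono m :: ('v, 'a) mpoly) (chi X I J (I - Y) + k - 1)"
        using Y(3) by (simp add: deg_le_def)
      then show ?thesis using False Y by (auto simp: S_gens_def intro: single_in_sym_alg)
    qed
    then show "pmono m * p_prod B X Y \<in> P_space B X I k J"
      unfolding P_space_def by (rule pm.span_base)
  qed (simp add: P_space_def)
qed

section \<open>Change of basis\<close>

lemma p_elt_add: "p_elt B (u + w) = p_elt B u + p_elt B w"
  by (simp add: p_elt_def pm.scale_left_distrib sum.distrib)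

lemma p_elt_fscale: "p_elt B (fscale c u) = pscale c (p_elt B u)"
  by (simp add: p_elt_def fscale_def pm.scale_sum_right)

lemma p_elt_0: "p_elt B 0 = 0"
  by (simp add: p_elt_def)

lemma p_elt_sum: "p_elt B (\<Sum>j\<in>A. u j) = (\<Sum>j\<in>A. p_elt B (u j))"
  using sum_comp_morphism[of "p_elt B", OF p_elt_0 p_elt_add, of u A] by (simp only: comp_def)

text \<open>The dual basis: \<open>representation\<close> is 0 outside the span of the basis, in
  agreement with the convention of \<open>dual_space\<close> outside \<open>V\<close>.\<close>

definition dual_vec :: "('a::field \<Rightarrow> 'v::ab_group_add \<Rightarrow> 'v) \<Rightarrow> 'v set \<Rightarrow> 'v \<Rightarrow> 'v \<Rightarrow> 'a" where
  "dual_vec scale B b = (\<lambda>v. module.representation scale B v b)"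

text \<open>The identity of Sym(U), rewritten from coordinates in \<open>B\<close> to coordinates in
  \<open>C\<close>: the variable \<open>b\<close> stands for the linear form
  \<open>dual_vec scale B b\<close>.\<close>

definition basis_change :: "('a::field \<Rightarrow> 'v::ab_group_add \<Rightarrow> 'v) \<Rightarrow> 'v set \<Rightarrow> 'v set
    \<Rightarrow> ('v, 'a) mpoly \<Rightarrow> ('v, 'a) mpoly" where
  "basis_change scale B C = psubst (\<lambda>b. p_elt C (dual_vec scale B b))"

context
  fixes scale :: "'a::field \<Rightarrow> 'v::ab_group_add \<Rightarrow> 'v"
  assumes vs: "vector_space scale"
begin

interpretation vector_space scale by (rule vs)

context
  fixes V B :: "'v set"
  assumes basis: "is_basis scale V B"
begin

lemma is_basisD: "finite B" "independent B" "span B = V"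
  using basis by (auto simp: is_basis_def)

lemma basis_sub: "B \<subseteq> V"
  using is_basisD span_superset by blast

lemma dual_vec_in_dual_space: "dual_vec scale B b \<in> dual_space scale V"
  using is_basisD
  by (auto simp: dual_space_def dual_vec_def representation_add representation_scale)
     (simp add: representation_def)

lemma dual_vec_basis: "b' \<in> B \<Longrightarrow> dual_vec scale B b b' = (if b' = b then 1 else 0)"
  using is_basisD by (simp add: dual_vec_def representation_basis)

lemma p_elt_dual_vec: "b \<in> B \<Longrightarrow> p_elt B (dual_vec scale B b) = var b"
proof -
  assume b: "b \<in> B"
  have "p_elt B (dual_vec scale B b) = (\<Sum>b'\<in>B. if b' = b then var b' else 0)"
    unfolding p_elt_def by (rule sum.cong) (simp_all add: dual_vec_basis)
  then show ?thesis using b is_basisD(1) by simp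
qed

lemma dual_space_sum:
  assumes "u \<in> dual_space scale V" "finite A" "\<And>a. a \<in> A \<Longrightarrow> f a \<in> V"
  shows "u (\<Sum>a\<in>A. scale (c a) (f a)) = (\<Sum>a\<in>A. c a * u (f a))"
  using assms(2,3)
proof (induction A)
  case empty
  have "u (scale 0 0) = 0 * u 0"
    using assms(1) is_basisD(3) span_zero[of B] unfolding dual_space_def by blast
  then show ?case by simp
next
  case (insert a A)
  have "(\<Sum>a\<in>A. scale (c a) (f a)) \<in> V" "scale (c a) (f a) \<in> V"
    using insert.prems is_basisD(3) by (auto intro: span_sum span_scale)
  then show ?case
    using insert assms(1) by (simp add: dual_space_def)
qed

lemma dual_space_expand:
  assumes "u \<in> dual_space scale V"
  shows "u = (\<Sum>b\<in>B. fscale (u b) (dual_vec scale B b))"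
proof
  fix v
  have app: "(\<Sum>b\<in>A. g b) v = (\<Sum>b\<in>A. g b v)" for A :: "'v set" and g :: "'v \<Rightarrow> 'v \<Rightarrow> 'a"
    by (induction A rule: infinite_finite_induct) auto
  show "u v = (\<Sum>b\<in>B. fscale (u b) (dual_vec scale B b)) v"
  proof (cases "v \<in> V")
    case True
    have "u v = u (\<Sum>b\<in>B. scale (representation B v b) b)"
      using sum_representation_eq[of B v B] is_basisD True by simp
    also have "\<dots> = (\<Sum>b\<in>B. representation B v b * u b)"
      using basis_sub by (intro dual_space_sum assms is_basisD(1)) auto
    finally show ?thesis by (simp add: app fscale_def dual_vec_def mult.commute)
  next
    case False
    then have "dual_vec scale B b v = 0" for b
      using dual_vec_in_dual_space by (auto simp: dual_space_def)
    then show ?thesis using False assms by (simp add: app fscale_def dual_space_def)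
  qed
qed

lemma independent_dual_vec: "fn.independent (dual_vec scale B ` B)" "inj_on (dual_vec scale B) B"
proof -
  show inj: "inj_on (dual_vec scale B) B"
    by (rule inj_onI) (metis dual_vec_basis zero_neq_one)
  show "fn.independent (dual_vec scale B ` B)"
  proof (rule fn.independent_if_scalars_zero)
    show "finite (dual_vec scale B ` B)" using is_basisD(1) by blast
    fix g u assume g: "(\<Sum>u\<in>dual_vec scale B ` B. fscale (g u) u) = 0" and "u \<in> dual_vec scale B ` B"
    then obtain b where b: "b \<in> B" "u = dual_vec scale B b" by blast
    have app: "(\<Sum>b\<in>A. h b) v = (\<Sum>b\<in>A. h b v)" for A :: "'v set" and h :: "'v \<Rightarrow> 'v \<Rightarrow> 'a" and v
      by (induction A rule: infinite_finite_induct) auto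
    have "(\<Sum>b'\<in>B. fscale (g (dual_vec scale B b')) (dual_vec scale B b')) b = 0"
      using g by (simp add: sum.reindex[OF inj])
    then have "(\<Sum>b'\<in>B. if b' = b then g (dual_vec scale B b') else 0) = 0"
      unfolding app fscale_def using b(1)
      by (subst (asm) sum.cong[OF refl, of _ _ "\<lambda>b'. if b' = b then g (dual_vec scale B b') else 0"])
         (auto simp: dual_vec_basis)
    then show "g u = 0" using b is_basisD(1) by simp
  qed
qed

text \<open>Gives the rank of the whole sequence, which is compared with the rank after removal of
  the coloop.\<close>

lemma dim_dual_space: "fn.dim (dual_space scale V) = card B"
proof -
  have "dual_space scale V \<subseteq> fn.span (dual_vec scale B ` B)"
  proof
    fix u assume u: "u \<in> dual_space scale V"
    show "u \<in> fn.span (dual_vec scale B ` B)"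
      by (subst dual_space_expand[OF u]) (intro fn.span_sum fn.span_scale fn.span_base imageI)
  qed
  then have "fn.dim (dual_space scale V) = card (dual_vec scale B ` B)"
    using dual_vec_in_dual_space independent_dual_vec(1)
    by (intro fn.dim_unique[of "dual_vec scale B ` B"]) auto
  then show ?thesis by (simp add: card_image independent_dual_vec(2))
qed

lemma basis_change_p_elt:
  assumes "u \<in> dual_space scale V"
  shows "basis_change scale B C (p_elt B u) = p_elt C u"
  by (subst (2) dual_space_expand[OF assms])
     (simp add: basis_change_def p_elt_def[of B] psubst_sum psubst_pscale psubst_var p_elt_sum
       p_elt_fscale)

lemma basis_change_p_prod:
  assumes "\<And>j. j \<in> Y \<Longrightarrow> X j \<in> dual_space scale V"
  shows "basis_change scale B C (p_prod B X Y) = p_prod C X Y"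
  using assms basis_change_p_elt
  by (simp add: p_prod_def basis_change_def psubst_prod)

lemma basis_change_in_sym_alg: "f \<in> sym_alg B \<Longrightarrow> basis_change scale B C f \<in> sym_alg C"
  unfolding basis_change_def by (erule psubst_in_sym_alg) (rule p_elt_in_sym_alg)

lemma basis_change_homogeneous:
  "f \<in> homogeneous d \<Longrightarrow> basis_change scale B C f \<in> homogeneous d"
  unfolding basis_change_def by (rule psubst_homogeneous[OF p_elt_homogeneous])

end

context
  fixes V B C :: "'v set"
  assumes B: "is_basis scale V B" and C: "is_basis scale V C"
begin

text \<open>Both substitutions respect the underlying linear form, and every variable is
  \<open>p_elt\<close> of a dual basis vector.\<close>

lemma basis_change_inverse:
  assumes "f \<in> sym_alg B"
  shows "basis_change scale C B (basis_change scale B C f) = f"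
  using assms
proof (induction f rule: sym_alg_induct)
  case (var b)
  have "basis_change scale C B (p_elt C (dual_vec scale B b)) = p_elt B (dual_vec scale B b)"
    by (rule basis_change_p_elt[OF C dual_vec_in_dual_space[OF B]])
  then show ?case
    using p_elt_dual_vec[OF B var] by (simp add: basis_change_def psubst_var)
qed (simp_all add: basis_change_def psubst_const psubst_add psubst_mult)

text \<open>Both sides obey the same Leibniz rule, and on a linear form both give the constant
  \<open>u v\<close>, in which no coordinates occur.\<close>

lemma basis_change_D_elt:
  assumes "f \<in> sym_alg B" "v \<in> V"
  shows "basis_change scale B C (sym_act (D_elt scale B v) f)
    = sym_act (D_elt scale C v) (basis_change scale B C f)"
  using assms(1)
proof (induction f rule: sym_alg_induct)
  case (const c)
  then show ?case by (simp add: basis_change_def psubst_const sym_act_D_elt_const)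
next
  case (var b)
  let ?u = "dual_vec scale B b"
  have u: "?u \<in> dual_space scale V" by (rule dual_vec_in_dual_space[OF B])
  have "sym_act (D_elt scale B v) (p_elt B ?u) = const (?u v)"
    by (rule sym_act_D_elt_p_elt[OF vs B u assms(2)])
  moreover have "sym_act (D_elt scale C v) (p_elt C ?u) = const (?u v)"
    by (rule sym_act_D_elt_p_elt[OF vs C u assms(2)])
  ultimately show ?case
    using p_elt_dual_vec[OF B var] basis_change_p_elt[OF B u, of C]
    by (simp add: basis_change_def psubst_const)
next
  case (add f g)
  then show ?case by (simp add: basis_change_def psubst_add sym_act_add_right)
next
  case (mult f g)
  then show ?case
    by (simp add: basis_change_def psubst_add psubst_mult sym_act_D_elt_mult)
qed

lemma basis_change_D_elt_power:
  assumes "f \<in> sym_alg B" "v \<in> V"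
  shows "basis_change scale B C (sym_act (D_elt scale B v ^ n) f)
    = sym_act (D_elt scale C v ^ n) (basis_change scale B C f)"
proof (induction n)
  case 0
  show ?case by (simp add: sym_act_one)
next
  case (Suc n)
  then show ?case
    using basis_change_D_elt[OF sym_act_in_sym_alg[OF assms(1)] assms(2)]
    by (simp add: sym_act_mult)
qed

end

section \<open>Basis independence of the Hilbert series\<close>

lemma Hilb_basis_change:
  assumes B: "is_basis scale V B" and C: "is_basis scale V C"
    and W: "pm.subspace W" "W \<subseteq> sym_alg B"
  shows "Hilb (basis_change scale B C ` W) = Hilb W"
proof -
  let ?f = "basis_change scale B C"
  have inv: "basis_change scale C B (?f g) = g" if "g \<in> W" for g
    using that W(2) basis_change_inverse[OF B C] by blast
  have "pm.dim (?f ` W \<inter> homogeneous d) = pm.dim (W \<inter> homogeneous d)" for d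
  proof -
    have "?f ` W \<inter> homogeneous d = ?f ` (W \<inter> homogeneous d)"
    proof (intro equalityI subsetI)
      fix h assume "h \<in> ?f ` W \<inter> homogeneous d"
      then obtain g where g: "g \<in> W" "h = ?f g" "h \<in> homogeneous d" by blast
      \<comment> \<open>The inverse substitution preserves degrees as well.\<close>
      then have "g \<in> homogeneous d"
        using basis_change_homogeneous[OF C, of h d B] inv by simp
      then show "h \<in> ?f ` (W \<inter> homogeneous d)" using g by blast
    qed (auto intro: basis_change_homogeneous[OF B])
    moreover have "inj_on ?f (W \<inter> homogeneous d)"
      by (rule inj_on_inverseI[of _ "basis_change scale C B"]) (use inv in blast)
    then have "pm.dim (?f ` (W \<inter> homogeneous d)) = pm.dim (W \<inter> homogeneous d)"
      unfolding basis_change_def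
      by (rule pm_pair.dim_image_inj_on[OF linear_psubst
            pm.subspace_inter[OF W(1) subspace_homogeneous]])
    ultimately show ?thesis by simp
  qed
  then show ?thesis by (simp add: Hilb_def)
qed

text \<open>A monomial may turn into a combination of many monomials, but of the same degree, so the
  bound \<open>c Y\<close> survives; the products of linear forms are carried to each other.\<close>

lemma basis_change_gspace_sub:
  assumes B: "is_basis scale V B" and C: "is_basis scale V C"
    and X: "\<And>j. j \<in> I \<Longrightarrow> X j \<in> dual_space scale V"
  shows "basis_change scale B C ` gspace B X I c \<subseteq> gspace C X I c"
proof -
  let ?f = "basis_change scale B C"
  have lin: "Vector_Spaces.linear pscale pscale ?f"
    unfolding basis_change_def by (rule linear_psubst)
  have "gspace B X I c \<subseteq> ?f -` gspace C X I c"
  proof (rule gspace_minimal)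
    show "pm.subspace (?f -` gspace C X I c)"
      by (rule pm_pair.linear_subspace_vimage[OF lin subspace_gspace])
    fix m Y assume Y: "Y \<subseteq> I" "Poly_Mapping.keys m \<subseteq> B" "mdeg m < c Y"
    have "?f (pmono m * p_prod B X Y) = ?f (pmono m) * p_prod C X Y"
      using basis_change_p_prod[OF B, of Y X C] Y(1) X
      by (simp add: basis_change_def psubst_mult subset_iff)
    moreover have "?f (pmono m) \<in> homogeneous (mdeg m)"
      by (rule basis_change_homogeneous[OF B mono_homogeneous])
    then have "deg_le (?f (pmono m)) (mdeg m)" by (simp add: homogeneous_def deg_le_def)
    moreover have "?f (pmono m) \<in> sym_alg C"
      by (rule basis_change_in_sym_alg[OF B single_in_sym_alg[OF Y(2)]])
    ultimately show "pmono m * p_prod B X Y \<in> ?f -` gspace C X I c"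
      using Y by (simp add: mult_in_gspace)
  qed
  then show ?thesis by blast
qed

lemma Hilb_gspace_basis:
  assumes B: "is_basis scale V B" and C: "is_basis scale V C"
    and X: "\<And>j. j \<in> I \<Longrightarrow> X j \<in> dual_space scale V"
  shows "Hilb (gspace B X I c) = Hilb (gspace C X I c)"
proof -
  have "gspace C X I c \<subseteq> basis_change scale B C ` gspace B X I c"
  proof
    fix f assume f: "f \<in> gspace C X I c"
    then have "f = basis_change scale B C (basis_change scale C B f)"
      using basis_change_inverse[OF C B] gspace_sub_sym_alg by fastforce
    moreover have "basis_change scale C B f \<in> gspace B X I c"
      by (rule subsetD[OF basis_change_gspace_sub[OF C B X] imageI[OF f]])
    ultimately show "f \<in> basis_change scale B C ` gspace B X I c" by blast
  qed
  then have "basis_change scale B C ` gspace B X I c = gspace C X I c"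
    by (intro equalityI basis_change_gspace_sub[OF B C X])
  then show ?thesis
    using Hilb_basis_change[OF B C subspace_gspace gspace_sub_sym_alg] by metis
qed

lemma basis_change_ker_sub:
  assumes B: "is_basis scale V B" and C: "is_basis scale V C"
  shows "basis_change scale B C ` ker B (power_ideal scale B X I k J)
    \<subseteq> ker C (power_ideal scale C X I k J)"
proof -
  have "span B = V" "span C = V" using is_basisD[OF B] is_basisD[OF C] by auto
  moreover have "sym_act (D_elt scale C \<eta> ^ n) (basis_change scale B C f) = 0"
    if "f \<in> sym_alg B" "\<eta> \<in> V" "sym_act (D_elt scale B \<eta> ^ n) f = 0" for f \<eta> n
    using basis_change_D_elt_power[OF B C that(1,2), of n] that(3) by (simp add: basis_change_def)
  ultimately show ?thesis
    unfolding ker_power_ideal using basis_change_in_sym_alg[OF B] by blast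
qed

lemma Hilb_ker_basis:
  assumes B: "is_basis scale V B" and C: "is_basis scale V C"
  shows "Hilb (ker B (power_ideal scale B X I k J)) = Hilb (ker C (power_ideal scale C X I k J))"
proof -
  let ?K = "\<lambda>B. ker B (power_ideal scale B X I k J)"
  have sub: "?K B \<subseteq> sym_alg B" for B by (auto simp: ker_def)
  have "?K C \<subseteq> basis_change scale B C ` ?K B"
  proof
    fix f assume f: "f \<in> ?K C"
    then have "f = basis_change scale B C (basis_change scale C B f)"
      using basis_change_inverse[OF C B] sub by fastforce
    moreover have "basis_change scale C B f \<in> ?K B"
      using basis_change_ker_sub[OF C B] f by blast
    ultimately show "f \<in> basis_change scale B C ` ?K B" by blast
  qed
  then have "basis_change scale B C ` ?K B = ?K C"
    using basis_change_ker_sub[OF B C] by blast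
  then show ?thesis
    using Hilb_basis_change[OF B C subspace_ker sub] by metis
qed

end

section \<open>Closure and contraction of a coloop\<close>

context vector_space
begin

lemma dim_insert_eq_iff:
  assumes "finite S"
  shows "dim (insert a S) = dim S \<longleftrightarrow> a \<in> span S"
proof
  assume eq: "dim (insert a S) = dim S"
  show "a \<in> span S"
  proof (rule ccontr)
    assume a: "a \<notin> span S"
    obtain T where T: "T \<subseteq> S" "independent T" "S \<subseteq> span T" "card T = dim S"
      using basis_exists by blast
    have sp: "span T = span S"
      using span_mono[OF T(1)] span_minimal[OF T(3) subspace_span] by (rule equalityI)
    have aT: "a \<notin> T" using a sp span_base by metis
    have "independent (insert a T)"
      using T(2) a sp independent_insertI by metis
    moreover have "span (insert a T) = span (insert a S)"
      by (simp add: span_insert sp)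
    ultimately have "dim (insert a S) = card (insert a T)"
      by (metis dim_span_eq_card_independent dim_span)
    moreover have "finite T" using T(1) assms by (rule finite_subset)
    ultimately show False using aT eq T(4) by simp
  qed
next
  assume "a \<in> span S"
  then show "dim (insert a S) = dim S"
    by (intro span_eq_dim span_redundant)
qed

end

lemma mem_clos:
  assumes "finite Y"
  shows "j \<in> clos X I Y \<longleftrightarrow> j \<in> I \<and> X j \<in> fn.span (X ` Y)"
  using fn.dim_insert_eq_iff[of "X ` Y" "X j"] assms by (simp add: clos_def rank_def)

lemma chi_le_1: "chi X I J A \<le> 1"
  by (simp add: chi_def)

lemma linear_restr: "Vector_Spaces.linear fscale fscale (restr W)"
  by unfold_locales (auto simp: restr_def fscale_def fun_eq_iff)

lemma subspace_dual_space: "fn.subspace (dual_space scale V)"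
  by (rule fn.subspaceI) (auto simp: dual_space_def fscale_def algebra_simps)

lemma sym_act_var_eq_0:
  assumes "f \<in> sym_alg B" "e \<notin> B"
  shows "sym_act (var e) f = 0"
proof -
  have "Poly_Mapping.lookup n e = 0" if "n \<in> Poly_Mapping.keys f" for n
  proof -
    have "Poly_Mapping.keys n \<subseteq> B" using that assms(1) by (simp add: sym_alg_def)
    then have "e \<notin> Poly_Mapping.keys n" using assms(2) by blast
    then show ?thesis by (simp add: in_keys_iff)
  qed
  then show ?thesis
    by (subst sym_act_superset[of "{Poly_Mapping.single e 1}" _ "Poly_Mapping.keys f"])
       (auto simp: var_def diff_coeff_var[unfolded One_nat_def] intro!: sum.neutral)
qed

text \<open>Exponents containing \<open>e\<close> stay distinct when lowered at \<open>e\<close>, so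
  nothing cancels in the derivative; the factor \<open>lookup n e\<close> is nonzero in
  characteristic zero.\<close>

lemma sym_alg_of_sym_act_var:
  fixes f :: "('v, 'a::field_char_0) mpoly"
  assumes f: "f \<in> sym_alg (insert e B)" and zero: "sym_act (var e) f = 0"
  shows "f \<in> sym_alg B"
proof -
  let ?e = "Poly_Mapping.single e (1::nat)"
  have "e \<notin> Poly_Mapping.keys n" if n: "n \<in> Poly_Mapping.keys f" for n
  proof
    assume e: "e \<in> Poly_Mapping.keys n"
    have inj: "n' - ?e = n - ?e \<longleftrightarrow> n' = n" if "e \<in> Poly_Mapping.keys n'" for n'
      using exponent_split[OF that] exponent_split[OF e] by (metis add_diff_cancel_right')
    have "Poly_Mapping.lookup (sym_act (var e) f) (n - ?e)
        = (\<Sum>n'\<in>Poly_Mapping.keys f. Poly_Mapping.lookup (Poly_Mapping.single (n' - ?e)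
            (Poly_Mapping.lookup f n' * of_nat (Poly_Mapping.lookup n' e))) (n - ?e))"
      by (subst sym_act_superset[of "{?e}" _ "Poly_Mapping.keys f"])
         (auto simp: var_def diff_coeff_var[unfolded One_nat_def] lookup_sum)
    also have "\<dots> = (\<Sum>n'\<in>Poly_Mapping.keys f. if n' = n
        then Poly_Mapping.lookup f n * of_nat (Poly_Mapping.lookup n e) else 0)"
    proof (rule sum.cong[OF refl])
      fix n'
      show "Poly_Mapping.lookup (Poly_Mapping.single (n' - ?e)
            (Poly_Mapping.lookup f n' * of_nat (Poly_Mapping.lookup n' e))) (n - ?e)
          = (if n' = n then Poly_Mapping.lookup f n * of_nat (Poly_Mapping.lookup n e) else 0)"
        using inj[of n'] e
        by (cases "e \<in> Poly_Mapping.keys n'") (auto simp: lookup_single when_def in_keys_iff)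
    qed
    also have "\<dots> = Poly_Mapping.lookup f n * of_nat (Poly_Mapping.lookup n e)"
      using n by simp
    finally show False using zero n e by (simp add: in_keys_iff)
  qed
  then show ?thesis using f by (fastforce simp: sym_alg_def)
qed

text \<open>A linear functional \<open>g\<close> on functions with \<open>g x = 1\<close> that
  vanishes on \<open>S\<close> exists by independence; on the dual of a finite-dimensional space it
  is evaluation at a vector.\<close>

lemma coloop_functional:
  fixes scale :: "'a::field \<Rightarrow> 'v::ab_group_add \<Rightarrow> 'v"
  assumes vs: "vector_space scale" and B: "is_basis scale V B"
    and S: "S \<subseteq> dual_space scale V" and x: "x \<in> dual_space scale V" "x \<notin> fn.span S"
  obtains e where "e \<in> V" "x e = 1" "\<And>u. u \<in> S \<Longrightarrow> u e = 0"
proof -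
  interpret vs: vector_space scale by (rule vs)
  interpret vp: vector_space_pair "fscale :: 'a \<Rightarrow> ('v \<Rightarrow> 'a) \<Rightarrow> _" "(*) :: 'a \<Rightarrow> 'a \<Rightarrow> 'a"
    by unfold_locales (auto simp: algebra_simps)
  obtain T where T: "T \<subseteq> S" "fn.independent T" "S \<subseteq> fn.span T"
    by (rule fn.basis_exists)
  have "fn.span T \<subseteq> fn.span S" using T(1) by (rule fn.span_mono)
  then have xT: "x \<notin> fn.span T" using x(2) by blast
  then have ind: "fn.independent (insert x T)"
    using T(2) by (rule fn.independent_insertI)
  define g where "g = vp.construct (insert x T) (\<lambda>u. if u = x then 1 else 0)"
  have g: "Vector_Spaces.linear fscale (*) g"
    unfolding g_def by (rule vp.linear_construct[OF ind])
  have gx: "g x = 1" using vp.construct_basis[OF ind] by (simp add: g_def)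
  have gT: "g u = 0" if "u \<in> T" for u
    using that vp.construct_basis[OF ind, of u] xT fn.span_base by (auto simp: g_def)
  have gS: "g u = 0" if "u \<in> S" for u
    using vp.linear_eq_0_on_span[OF g gT] that T(3) by blast
  \<comment> \<open>The coordinates of the vector representing \<open>g\<close> are the values of
    \<open>g\<close> on the dual basis.\<close>
  define e where "e = (\<Sum>b\<in>B. scale (g (dual_vec scale B b)) b)"
  have BV: "B \<subseteq> V" by (rule basis_sub[OF vs B])
  have ue: "u e = g u" if u: "u \<in> dual_space scale V" for u
  proof -
    have "u e = (\<Sum>b\<in>B. g (dual_vec scale B b) * u b)"
      unfolding e_def using BV by (intro dual_space_sum[OF vs B u] is_basisD(1)[OF vs B]) auto
    also have "\<dots> = g (\<Sum>b\<in>B. fscale (u b) (dual_vec scale B b))"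
      by (simp add: vp.linear_sum[OF g] vp.linear_scale[OF g] mult.commute)
    also have "\<dots> = g u"
      using dual_space_expand[OF vs B u] by simp
    finally show ?thesis .
  qed
  have "e \<in> vs.span B"
    unfolding e_def by (intro vs.span_sum vs.span_scale vs.span_base)
  then have "e \<in> V" using is_basisD(3)[OF vs B] by simp
  then show ?thesis using that ue x(1) S gx gS by (simp add: subset_iff)
qed

text \<open>Here \<open>B\<close> is a basis of the kernel of \<open>X i\<close>, and the vector
  \<open>e\<close> witnesses that \<open>X i\<close> is a coloop; \<open>insert e B\<close> is the
  adapted basis of \<open>V\<close>.\<close>

locale coloop =
  fixes scale :: "'a::field \<Rightarrow> 'v::ab_group_add \<Rightarrow> 'v"
    and V B :: "'v set" and e :: 'v
    and X :: "'i \<Rightarrow> 'v \<Rightarrow> 'a" and I :: "'i set" and i :: 'i and J :: "'i set set"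
  assumes vs: "vector_space scale"
    and basis_contr: "is_basis scale (contr_space V (X i)) B"
    and subspace_V: "module.subspace scale V"
    and e: "e \<in> V" "X i e = 1" "\<And>j. j \<in> I - {i} \<Longrightarrow> X j e = 0"
    and fin: "finite I" and i: "i \<in> I"
    and X: "\<And>j. j \<in> I \<Longrightarrow> X j \<in> dual_space scale V"
    and spanning: "fn.span (X ` I) = dual_space scale V"
    and upper: "upper_set X I J"
begin

sublocale vector_space scale by (rule vs)

abbreviation H :: "'i set" where "H \<equiv> I - {i}"
abbreviation X' :: "'i \<Rightarrow> 'v \<Rightarrow> 'a" where "X' \<equiv> contr V X i"
abbreviation W :: "'v set" where "W \<equiv> contr_space V (X i)"

lemma finB: "finite B" and indB: "independent B" and spanB: "span B = W"
  using is_basisD[OF vs basis_contr] by auto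

lemma X_add: "j \<in> I \<Longrightarrow> v \<in> V \<Longrightarrow> w \<in> V \<Longrightarrow> X j (v + w) = X j v + X j w"
  and X_scale: "j \<in> I \<Longrightarrow> v \<in> V \<Longrightarrow> X j (scale c v) = c * X j v"
  using X by (auto simp: dual_space_def)

lemma e_notin_W: "e \<notin> W"
  using e by (simp add: contr_space_def)

lemma e_notin_B: "e \<notin> B"
  using e_notin_W spanB span_base by blast

lemma B_sub_W: "B \<subseteq> W"
  using spanB span_superset by blast

text \<open>Projection onto the kernel of \<open>X i\<close> along \<open>e\<close>, using
  \<open>X i e = 1\<close>.\<close>

lemma decompose:
  assumes "v \<in> V"
  shows "v - scale (X i v) e \<in> W"
proof -
  have "scale (- X i v) e \<in> V" using e(1) subspace_V by (rule subspace_scale[rotated])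
  then have "v + scale (- X i v) e \<in> V" "X i (v + scale (- X i v) e) = 0"
    using assms subspace_V X_add[OF i assms] X_scale[OF i e(1)] e(2)
    by (auto intro: subspace_add simp del: scale_minus_left)
  then show ?thesis by (simp add: contr_space_def)
qed

lemma basis_insert: "is_basis scale V (insert e B)"
proof -
  have "independent (insert e B)"
    using e_notin_W spanB indB by (intro independent_insertI) auto
  moreover have "V \<subseteq> span (insert e B)"
    using decompose unfolding subset_iff span_breakdown_eq spanB by blast
  moreover have "span (insert e B) \<subseteq> V"
    using B_sub_W e(1) by (intro span_minimal subspace_V) (auto simp: contr_space_def)
  ultimately show ?thesis using finB by (simp add: is_basis_def)
qed

lemma X'_eq: "v \<in> W \<Longrightarrow> X' j v = X j v"
  by (simp add: contr_def restr_def)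

text \<open>The coefficient at \<open>e\<close> is \<open>X j e = 0\<close>, and on \<open>B\<close>
  restriction changes no value, so contraction leaves these polynomials as they are.\<close>

lemma p_elt_insert: "j \<in> H \<Longrightarrow> p_elt (insert e B) (X j) = p_elt B (X' j)"
proof -
  assume j: "j \<in> H"
  have "(\<Sum>b\<in>B. pscale (X j b) (var b)) = (\<Sum>b\<in>B. pscale (X' j b) (var b))"
    using B_sub_W X'_eq by (intro sum.cong) auto
  then show ?thesis using finB e_notin_B e(3)[OF j] by (simp add: p_elt_def)
qed

lemma p_elt_coloop: "p_elt (insert e B) (X i) = var e"
proof -
  have "(\<Sum>b\<in>B. pscale (X i b) (var b)) = 0"
    using B_sub_W by (intro sum.neutral) (auto simp: contr_space_def)
  then show ?thesis using finB e_notin_B e(2) by (simp add: p_elt_def)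
qed

lemma p_prod_insert: "Y \<subseteq> H \<Longrightarrow> p_prod (insert e B) X Y = p_prod B X' Y"
  unfolding p_prod_def by (intro prod.cong refl p_elt_insert) auto

lemma p_prod_coloop:
  assumes "Y \<subseteq> I" "i \<in> Y"
  shows "p_prod (insert e B) X Y = var e * p_prod (insert e B) X (Y - {i})"
proof -
  have "finite Y" using assms(1) fin by (rule finite_subset)
  then show ?thesis
    using assms(2) p_elt_coloop prod.remove[of Y i "\<lambda>j. p_elt (insert e B) (X j)"]
    by (simp add: p_prod_def)
qed

section \<open>Spans, closures and indicators under contraction\<close>

lemma X'_mem_span_iff:
  assumes j: "j \<in> I" and A: "A \<subseteq> I"
  shows "X' j \<in> fn.span (X' ` A) \<longleftrightarrow> X j \<in> fn.span (insert (X i) (X ` A))"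
proof -
  interpret fp: vector_space_pair "fscale :: 'a \<Rightarrow> ('v \<Rightarrow> 'a) \<Rightarrow> _" "fscale :: 'a \<Rightarrow> ('v \<Rightarrow> 'a) \<Rightarrow> _" ..
  have sub: "u \<in> dual_space scale V" if "u \<in> fn.span (X ` A)" for u
    using fn.span_minimal[OF _ subspace_dual_space, of "X ` A" scale V] X A that by blast
  have im: "X' ` A = restr W ` X ` A" by (auto simp: contr_def)
  have "X' j \<in> fn.span (X' ` A) \<longleftrightarrow> (\<exists>u\<in>fn.span (X ` A). restr W (X j) = restr W u)"
    unfolding im fp.linear_span_image[OF linear_restr] by (auto simp: contr_def)
  \<comment> \<open>The kernel of restriction is the line through \<open>X i\<close>.\<close>
  also have "\<dots> \<longleftrightarrow> (\<exists>u\<in>fn.span (X ` A). X j - u \<in> fn.span {X i})"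
  proof (rule bex_cong[OF refl])
    fix u assume u: "u \<in> fn.span (X ` A)"
    have "X j - u \<in> dual_space scale V"
      by (rule fn.subspace_diff[OF subspace_dual_space X[OF j] sub[OF u]])
    then have "restr W (X j - u) = 0 \<longleftrightarrow> X j - u \<in> fn.span {X i}"
      by (rule restr_kernel[OF vs subspace_V X[OF i]])
    moreover have "restr W (X j - u) = restr W (X j) - restr W u"
      by (rule fp.linear_diff[OF linear_restr])
    ultimately show "restr W (X j) = restr W u \<longleftrightarrow> X j - u \<in> fn.span {X i}"
      by (metis eq_iff_diff_eq_0)
  qed
  also have "\<dots> \<longleftrightarrow> (\<exists>k. X j - fscale k (X i) \<in> fn.span (X ` A))"
  proof
    assume "\<exists>u\<in>fn.span (X ` A). X j - u \<in> fn.span {X i}"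
    then obtain u k where "u \<in> fn.span (X ` A)" "X j - u = fscale k (X i)"
      by (auto simp: fn.span_singleton)
    moreover from this have "X j - fscale k (X i) = u"
      by (metis diff_diff_eq2 diff_add_cancel add.commute add_diff_cancel_left')
    ultimately show "\<exists>k. X j - fscale k (X i) \<in> fn.span (X ` A)" by metis
  next
    assume "\<exists>k. X j - fscale k (X i) \<in> fn.span (X ` A)"
    then obtain k where k: "X j - fscale k (X i) \<in> fn.span (X ` A)" ..
    have "X j - (X j - fscale k (X i)) = fscale k (X i)"
      by (rule diff_diff_eq2[THEN trans]) (rule add_diff_cancel_left')
    then show "\<exists>u\<in>fn.span (X ` A). X j - u \<in> fn.span {X i}"
      using k by (metis fn.span_base fn.span_scale singletonI)
  qed
  also have "\<dots> \<longleftrightarrow> X j \<in> fn.span (insert (X i) (X ` A))"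
    by (rule fn.span_breakdown_eq[symmetric])
  finally show ?thesis .
qed

lemma span_vanish_e:
  assumes "A \<subseteq> H" "u \<in> fn.span (X ` A)"
  shows "u e = 0"
proof -
  have "fn.subspace {u. u e = 0}" by (rule fn.subspaceI) (auto simp: fscale_def)
  then have "fn.span (X ` A) \<subseteq> {u. u e = 0}"
    using assms(1) e(3) by (intro fn.span_minimal) auto
  then show ?thesis using assms(2) by blast
qed

lemma clos_insert_coloop:
  assumes A: "A \<subseteq> H"
  shows "clos X I (insert i A) = insert i (clos X' H A)"
proof (rule set_eqI)
  fix j
  have finA: "finite A" using A fin by (metis finite_Diff finite_subset)
  then have "j \<in> clos X I (insert i A) \<longleftrightarrow> j \<in> I \<and> X j \<in> fn.span (insert (X i) (X ` A))"
    by (simp add: mem_clos)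
  also have "\<dots> \<longleftrightarrow> j = i \<or> j \<in> H \<and> X' j \<in> fn.span (X' ` A)"
    using X'_mem_span_iff[of j A] A i fn.span_base[of "X i" "insert (X i) (X ` A)"] by auto
  also have "\<dots> \<longleftrightarrow> j \<in> insert i (clos X' H A)"
    using finA by (simp add: mem_clos)
  finally show "j \<in> clos X I (insert i A) \<longleftrightarrow> j \<in> insert i (clos X' H A)" .
qed

text \<open>A relation modulo \<open>X i\<close> among the other entries is a true relation:
  evaluation at \<open>e\<close> shows its coefficient at \<open>X i\<close> to be 0. In the same
  way, \<open>X i\<close> itself never enters the closure.\<close>

lemma clos_coloop:
  assumes A: "A \<subseteq> H"
  shows "clos X I A = clos X' H A"
proof (rule set_eqI)
  fix j
  have finA: "finite A" using A fin by (metis finite_Diff finite_subset)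
  have "X j \<in> fn.span (X ` A)" if j: "j \<in> H" "X j \<in> fn.span (insert (X i) (X ` A))"
  proof -
    obtain k where k: "X j - fscale k (X i) \<in> fn.span (X ` A)"
      using j(2) unfolding fn.span_breakdown_eq ..
    have "(X j - fscale k (X i)) e = 0" by (rule span_vanish_e[OF A k])
    then have "k = 0" using e(2,3) j(1) by (simp add: fscale_def)
    then show ?thesis using k by simp
  qed
  moreover have "X j \<in> fn.span (insert (X i) (X ` A))" if "X j \<in> fn.span (X ` A)"
    using that fn.span_mono[OF subset_insertI] by blast
  moreover have "X i \<notin> fn.span (X ` A)"
    using span_vanish_e[OF A, of "X i"] e(2) by auto
  ultimately show "j \<in> clos X I A \<longleftrightarrow> j \<in> clos X' H A"
    using X'_mem_span_iff[of j A] A finA i by (auto simp: mem_clos)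
qed

lemma H_flat: "clos X I H = H" "H \<in> flats X I"
proof -
  have "X' j \<in> fn.span (X' ` H)" if "j \<in> H" for j
    using that by (intro fn.span_base imageI)
  then have "clos X' H H = H"
    using fin mem_clos[of H _ X' H] by blast
  then show "clos X I H = H" by (simp add: clos_coloop)
  then show "H \<in> flats X I" by (auto simp: flats_def)
qed

text \<open>Deleting \<open>i\<close> loses nothing on sets that contain it, so membership in
  \<open>J_contr\<close> can be read back in \<open>J\<close>.\<close>

lemma chi_insert_coloop:
  assumes "A \<subseteq> H"
  shows "chi X I J (insert i A) = chi X' H (J_contr J i) A"
proof -
  have "i \<notin> clos X' H A" by (simp add: clos_def)
  then have "clos X' H A = insert i (clos X' H A) - {i}" by blast
  then have "insert i (clos X' H A) \<in> J \<longleftrightarrow> clos X' H A \<in> J_contr J i"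
    unfolding J_contr_def by (smt (verit) CollectD CollectI insertI1 insert_Diff)
  then show ?thesis by (simp add: chi_def clos_insert_coloop[OF assms])
qed

lemma clos_sub_H: "clos X' H A \<subseteq> H"
  by (auto simp: clos_def)

lemma H_in_J: "C \<in> J \<Longrightarrow> C \<subseteq> H \<Longrightarrow> H \<in> J"
  using upper H_flat(2) by (auto simp: upper_set_def)

text \<open>Closures of subsets of \<open>H\<close> avoid \<open>i\<close>, and the flat
  \<open>H\<close> adjoined in \<open>J_hat\<close> already belongs to \<open>J\<close>.\<close>

lemma chi_J_hat:
  assumes "H \<in> J" "A \<subseteq> H"
  shows "chi X I J A = chi X' H (J_hat I J i) A"
  using assms clos_sub_H[of A] by (auto simp: chi_def clos_coloop J_hat_def)

text \<open>Such closures stay inside \<open>H\<close>; one of them in \<open>J\<close> would force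
  \<open>H\<close> into the upper set. The same argument leaves only the adjoined flat in
  \<open>J_hat\<close>.\<close>

lemma chi_eq_0:
  assumes "H \<notin> J" "A \<subseteq> H"
  shows "chi X I J A = 0"
  using assms clos_sub_H[of A] H_in_J by (auto simp: chi_def clos_coloop)

lemma J_hat_eq: "H \<notin> J \<Longrightarrow> J_hat I J i = {H}"
  using H_in_J upper by (fastforce simp: J_hat_def upper_set_def flats_def)

text \<open>Restriction maps onto the dual of \<open>W\<close> and sends \<open>X i\<close> to 0, so
  the other entries still span.\<close>

lemma dual_space_contr: "fn.span (X' ` H) = dual_space scale W"
proof -
  interpret fp: vector_space_pair "fscale :: 'a \<Rightarrow> ('v \<Rightarrow> 'a) \<Rightarrow> _" "fscale :: 'a \<Rightarrow> ('v \<Rightarrow> 'a) \<Rightarrow> _" ..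
  have "dual_space scale W = restr W ` fn.span (X ` I)"
    unfolding spanning by (rule restr_onto[OF vs subspace_V X[OF i], symmetric])
  also have "\<dots> = fn.span (restr W ` X ` I)"
    by (rule fp.linear_span_image[OF linear_restr, symmetric])
  also have "restr W ` X ` I = insert (X' i) (X' ` H)"
    using i by (auto simp: contr_def)
  also have "X' i = 0" by (auto simp: contr_def restr_def contr_space_def fun_eq_iff)
  also have "fn.span (insert 0 (X' ` H)) = fn.span (X' ` H)"
    by (rule fn.span_redundant) (rule fn.span_zero)
  finally show ?thesis ..
qed

section \<open>The Hilbert series for nonnegative \<open>k\<close>\<close>

abbreviation shifted :: "('v, 'a) mpoly set \<Rightarrow> ('v, 'a) mpoly set \<Rightarrow> ('v, 'a) mpoly set" where
  "shifted P R \<equiv> {f + var e * g | f g. f \<in> P \<and> g \<in> R}"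

lemma subspace_shifted:
  assumes P: "pm.subspace P" and R: "pm.subspace R"
  shows "pm.subspace (shifted P R)"
proof -
  have "shifted P R = {f + h | f h. f \<in> P \<and> h \<in> (*) (var e) ` R}" by blast
  then show ?thesis
    using pm.subspace_sums[OF P pm_pair.linear_subspace_image[OF linear_mult R, of "var e"]] by simp
qed

lemma shifted_left: "pm.subspace R \<Longrightarrow> f \<in> P \<Longrightarrow> f \<in> shifted P R"
  using pm.subspace_0[of R] by force

lemma shifted_right: "pm.subspace P \<Longrightarrow> g \<in> R \<Longrightarrow> var e * g \<in> shifted P R"
  using pm.subspace_0[of P] by force

lemma shifted_sub:
  assumes "pm.subspace U" "P \<subseteq> U" "R \<subseteq> (*) (var e) -` U"
  shows "shifted P R \<subseteq> U"
  using assms pm.subspace_add[OF assms(1)] by blast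

lemma gspace_contr_sub:
  assumes "H \<subseteq> K"
  shows "gspace B X' H c \<subseteq> gspace (insert e B) X K c"
proof (rule gspace_minimal[OF subspace_gspace])
  fix m Y assume Y: "Y \<subseteq> H" "Poly_Mapping.keys m \<subseteq> B" "mdeg m < c Y"
  then show "pmono m * p_prod B X' Y \<in> gspace (insert e B) X K c"
    unfolding p_prod_insert[OF Y(1), symmetric]
    using assms by (intro mono_mult_in_gspace) auto
qed

text \<open>Sort monomials by divisibility by \<open>var e\<close>; cancelling one such factor
  lowers the degree by one. Truncation in \<open>c Y - 1\<close> is harmless: neither of the bounds
  0 and 1 admits a monomial divisible by \<open>var e\<close>.\<close>

lemma gspace_split:
  "gspace (insert e B) X H c
    = shifted (gspace B X' H c) (gspace (insert e B) X H (\<lambda>Y. c Y - 1))"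
    (is "?L = shifted ?P ?R")
proof (rule equalityI)
  show "?L \<subseteq> shifted ?P ?R"
  proof (rule gspace_minimal[OF subspace_shifted[OF subspace_gspace subspace_gspace]])
    fix m Y assume Y: "Y \<subseteq> H" "Poly_Mapping.keys m \<subseteq> insert e B" "mdeg m < c Y"
    show "pmono m * p_prod (insert e B) X Y \<in> shifted ?P ?R"
    proof (cases "e \<in> Poly_Mapping.keys m")
      case True
      then obtain n where n: "m = n + Poly_Mapping.single e 1" by (rule exponent_split)
      have "pmono n * p_prod (insert e B) X Y \<in> ?R"
        using Y n by (intro mono_mult_in_gspace) (auto simp: keys_add_nat)
      then have "var e * (pmono n * p_prod (insert e B) X Y) \<in> shifted ?P ?R"
        by (rule shifted_right[OF subspace_gspace])
      then show ?thesis by (simp only: n mono_single_Suc mult.assoc)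
    next
      case False
      then have "pmono m * p_prod B X' Y \<in> ?P"
        using Y by (intro mono_mult_in_gspace) auto
      then show ?thesis
        unfolding p_prod_insert[OF Y(1)] by (rule shifted_left[OF subspace_gspace])
    qed
  qed
  show "shifted ?P ?R \<subseteq> ?L"
  proof (rule shifted_sub[OF subspace_gspace gspace_contr_sub[OF order_refl]])
    show "?R \<subseteq> (*) (var e) -` ?L"
    proof (rule gspace_minimal[OF pm_pair.linear_subspace_vimage[OF linear_mult subspace_gspace]])
      fix m Y assume Y: "Y \<subseteq> H" "Poly_Mapping.keys m \<subseteq> insert e B" "mdeg m < c Y - 1"
      have "pmono (m + Poly_Mapping.single e 1) * p_prod (insert e B) X Y \<in> ?L"
        using Y by (intro mono_mult_in_gspace) (auto simp: keys_add_nat)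
      then show "pmono m * p_prod (insert e B) X Y \<in> (*) (var e) -` ?L"
        by (simp only: mono_single_Suc vimage_eq mult.assoc)
    qed
  qed
qed

text \<open>Products with \<open>i \<in> Y\<close> carry the factor \<open>var e\<close> themselves.
  Those with \<open>i \<notin> Y\<close> acquire it only from the monomial, leaving a cofactor
  bounded by \<open>c Y - 1\<close>; the assumption places these among the former.\<close>

lemma gspace_coloop:
  assumes c: "\<And>Y. Y \<subseteq> H \<Longrightarrow> c Y \<le> Suc (c (insert i Y))"
  shows "gspace (insert e B) X I c
    = shifted (gspace B X' H c) (gspace (insert e B) X H (\<lambda>Y. c (insert i Y)))"
    (is "?L = shifted ?P ?R")
proof (rule equalityI)
  have sub: "gspace (insert e B) X H c \<subseteq> shifted ?P ?R"
  proof -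
    have "gspace (insert e B) X H (\<lambda>Y. c Y - 1) \<subseteq> ?R"
      by (rule gspace_mono) (use c in \<open>simp add: le_diff_conv\<close>)
    then show ?thesis unfolding gspace_split[of c] by blast
  qed
  show "?L \<subseteq> shifted ?P ?R"
  proof (rule gspace_minimal[OF subspace_shifted[OF subspace_gspace subspace_gspace]])
    fix m Y assume Y: "Y \<subseteq> I" "Poly_Mapping.keys m \<subseteq> insert e B" "mdeg m < c Y"
    show "pmono m * p_prod (insert e B) X Y \<in> shifted ?P ?R"
    proof (cases "i \<in> Y")
      case True
      then have "pmono m * p_prod (insert e B) X (Y - {i}) \<in> ?R"
        using Y by (intro mono_mult_in_gspace) (auto simp: insert_absorb)
      then have "var e * (pmono m * p_prod (insert e B) X (Y - {i})) \<in> shifted ?P ?R"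
        by (rule shifted_right[OF subspace_gspace])
      then show ?thesis by (simp only: p_prod_coloop[OF Y(1) True] mult.left_commute)
    next
      case False
      then have "pmono m * p_prod (insert e B) X Y \<in> gspace (insert e B) X H c"
        using Y by (intro mono_mult_in_gspace) auto
      then show ?thesis using sub by (rule subsetD[rotated])
    qed
  qed
  show "shifted ?P ?R \<subseteq> ?L"
  proof (rule shifted_sub[OF subspace_gspace gspace_contr_sub[OF Diff_subset]])
    show "?R \<subseteq> (*) (var e) -` ?L"
    proof (rule gspace_minimal[OF pm_pair.linear_subspace_vimage[OF linear_mult subspace_gspace]])
      fix m Y assume Y: "Y \<subseteq> H" "Poly_Mapping.keys m \<subseteq> insert e B" "mdeg m < c (insert i Y)"
      have iY: "insert i Y \<subseteq> I" "insert i Y - {i} = Y" using Y(1) i by auto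
      have "pmono m * p_prod (insert e B) X (insert i Y) \<in> ?L"
        using Y iY(1) by (intro mono_mult_in_gspace)
      then show "pmono m * p_prod (insert e B) X Y \<in> (*) (var e) -` ?L"
        using p_prod_coloop[OF iY(1) insertI1] iY(2) by (simp add: mult.left_commute)
    qed
  qed
qed

lemma Hilb_shifted_gspace:
  "Hilb (shifted (gspace B X' H c) (gspace (insert e B) X H d))
    = Hilb (gspace B X' H c) + fps_X * Hilb (gspace (insert e B) X H d)"
  by (rule Hilb_add_var_mult[OF finB e_notin_B graded_gspace gspace_sub_sym_alg
        graded_gspace gspace_sub_sym_alg])

lemma Hilb_gspace_split:
  "Hilb (gspace (insert e B) X H c)
    = Hilb (gspace B X' H c) + fps_X * Hilb (gspace (insert e B) X H (\<lambda>Y. c Y - 1))"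
  unfolding gspace_split[of c] by (rule Hilb_shifted_gspace)

lemma Hilb_gspace_coloop:
  assumes "\<And>Y. Y \<subseteq> H \<Longrightarrow> c Y \<le> Suc (c (insert i Y))"
  shows "Hilb (gspace (insert e B) X I c)
    = Hilb (gspace B X' H c) + fps_X * Hilb (gspace (insert e B) X H (\<lambda>Y. c (insert i Y)))"
proof -
  have "gspace (insert e B) X I c
      = shifted (gspace B X' H c) (gspace (insert e B) X H (\<lambda>Y. c (insert i Y)))"
    by (rule gspace_coloop) (rule assms)
  then show ?thesis by (simp only: Hilb_shifted_gspace)
qed

section \<open>Recursion for the cofactor of the coloop\<close>

definition R_space :: "nat \<Rightarrow> ('v, 'a) mpoly set" where
  "R_space k = gspace (insert e B) X H (\<lambda>Y. chi X I J (H - Y) + k)"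

text \<open>The indicator is still that of \<open>J\<close> in \<open>X\<close>, so the recursion is
  the same whether or not \<open>H\<close> is in \<open>J\<close>; the comparison with
  \<open>J_hat\<close> is made afterwards.\<close>

definition Q_space :: "nat \<Rightarrow> ('v, 'a) mpoly set" where
  "Q_space k = gspace B X' H (\<lambda>Y. chi X I J (H - Y) + k)"

lemma Hilb_P_space:
  "Hilb (P_space (insert e B) X I k J)
    = Hilb (P_space B X' H k (J_contr J i)) + fps_X * Hilb (R_space k)"
proof -
  let ?c = "\<lambda>Y. chi X I J (I - Y) + k"
  \<comment> \<open>Since \<chi> takes only the values 0 and 1, removing \<open>i\<close> from the
    complement lowers the bound by at most one.\<close>
  have "?c Y \<le> Suc (?c (insert i Y))" for Y
    using chi_le_1[of X I J "I - Y"] by linarith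
  then have "Hilb (P_space (insert e B) X I k J)
      = Hilb (gspace B X' H ?c) + fps_X * Hilb (gspace (insert e B) X H (\<lambda>Y. ?c (insert i Y)))"
    unfolding P_space_eq_gspace by (rule Hilb_gspace_coloop)
  moreover have "gspace B X' H ?c = P_space B X' H k (J_contr J i)"
    unfolding P_space_eq_gspace
  proof (rule gspace_cong)
    fix Y assume "Y \<subseteq> H"
    \<comment> \<open>The coloop lies in the complement of \<open>Y\<close>, so the indicator
      becomes that of \<open>J_contr\<close>.\<close>
    then have "I - Y = insert i (H - Y)" using i by blast
    then show "?c Y = chi X' H (J_contr J i) (H - Y) + k"
      by (simp only: chi_insert_coloop[OF Diff_subset])
  qed
  moreover have "gspace (insert e B) X H (\<lambda>Y. ?c (insert i Y)) = R_space k"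
    unfolding R_space_def
  proof (rule gspace_cong)
    fix Y
    have "I - insert i Y = H - Y" by blast
    then show "?c (insert i Y) = chi X I J (H - Y) + k"
      by (rule arg_cong[where f = "\<lambda>A. chi X I J A + k"])
  qed
  ultimately show ?thesis by (simp only:)
qed

text \<open>Lowering the bound \<chi> \<le> 1 by one leaves 0, so no cofactor involves
  \<open>var e\<close>.\<close>

lemma Hilb_R_space_0: "Hilb (R_space 0) = Hilb (Q_space 0)"
proof -
  let ?c = "\<lambda>Y. chi X I J (H - Y) + 0"
  have "gspace (insert e B) X H (\<lambda>Y. ?c Y - 1) = {0}"
    by (rule gspace_zero) (simp add: chi_def)
  then show ?thesis
    using Hilb_gspace_split[of ?c]
    unfolding R_space_def Q_space_def by (simp only: Hilb_zero_space mult_zero_right add_0_right)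
qed

lemma Hilb_R_space_Suc: "Hilb (R_space (Suc k)) = Hilb (Q_space (Suc k)) + fps_X * Hilb (R_space k)"
proof -
  let ?c = "\<lambda>Y. chi X I J (H - Y) + Suc k"
  have "(\<lambda>Y. ?c Y - 1) = (\<lambda>Y. chi X I J (H - Y) + k)" by simp
  then show ?thesis
    using Hilb_gspace_split[of ?c] unfolding R_space_def Q_space_def by (simp only:)
qed

lemma Q_space_eq: "H \<in> J \<Longrightarrow> Q_space k = P_space B X' H k (J_hat I J i)"
  unfolding Q_space_def P_space_eq_gspace
  by (rule gspace_cong, subst chi_J_hat) (assumption, blast, rule refl)

lemma Q_space_0: "H \<notin> J \<Longrightarrow> Q_space 0 = {0}"
  unfolding Q_space_def by (rule gspace_zero) (simp add: chi_eq_0)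

text \<open>If the complement of \<open>Y\<close> spans, then every variable is a combination of the linear forms
  outside \<open>Y\<close>; this trades one degree of the cofactor of \<open>p\<^sub>Y\<close> for one more factor.\<close>

lemma Q_space_Suc:
  assumes "H \<notin> J"
  shows "Q_space (Suc k) = P_space B X' H (Suc k) (J_hat I J i)"
proof -
  let ?c = "\<lambda>Y. chi X' H (J_hat I J i) (H - Y) + Suc k"
  let ?Q = "gspace B X' H (\<lambda>Y. Suc k)"
  have Q: "Q_space (Suc k) = ?Q"
    unfolding Q_space_def by (intro gspace_cong) (simp add: chi_eq_0 assms)
  have "gspace B X' H ?c \<subseteq> ?Q"
  proof (rule gspace_minimal[OF subspace_gspace])
    fix m Y assume Y: "Y \<subseteq> H" "Poly_Mapping.keys m \<subseteq> B" "mdeg m < ?c Y"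
    show "pmono m * p_prod B X' Y \<in> ?Q"
    proof (cases "mdeg m < Suc k")
      case True
      then show ?thesis using Y by (intro mono_mult_in_gspace)
    next
      case False
      \<comment> \<open>What remains is a monomial of top degree with \<chi> = 1; since
        \<open>J_hat\<close> is {H}, the complement of \<open>Y\<close> then spans.\<close>
      then have deg: "mdeg m = Suc k" and "chi X' H (J_hat I J i) (H - Y) \<noteq> 0"
        using Y(3) chi_le_1[of X' H "J_hat I J i" "H - Y"] by auto
      then have cl: "clos X' H (H - Y) = H"
        by (simp add: chi_def J_hat_eq[OF assms] split: if_splits)
      have finHY: "finite (H - Y)" and finY: "finite Y"
        using fin Y(1) by (auto intro: finite_subset)
      have "m \<noteq> 0" using deg by auto
      then obtain b where b: "b \<in> Poly_Mapping.keys m"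
        by (metis in_keys_iff lookup_zero poly_mapping_eqI)
      then obtain n where n: "m = n + Poly_Mapping.single b 1" by (rule exponent_split)
      have bB: "b \<in> B" and nB: "Poly_Mapping.keys n \<subseteq> B"
        using Y(2) b by (auto simp: n keys_add_nat)
      have "X' j \<in> fn.span (X' ` (H - Y))" if "j \<in> H" for j
        using that mem_clos[OF finHY, of j X' H] cl by simp
      then have "fn.span (X' ` H) \<subseteq> fn.span (X' ` (H - Y))"
        by (intro fn.span_minimal fn.subspace_span) auto
      then have "dual_vec scale B b \<in> fn.span (X' ` (H - Y))"
        using dual_vec_in_dual_space[OF vs basis_contr, of b] dual_space_contr by blast
      then obtain a where a: "dual_vec scale B b = (\<Sum>z\<in>H - Y. fscale (a z) (X' z))"
        by (rule fn.span_image_expand[OF finHY])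
      have "var b = (\<Sum>z\<in>H - Y. pscale (a z) (p_elt B (X' z)))"
        unfolding p_elt_dual_vec[OF vs basis_contr bB, symmetric] a p_elt_sum p_elt_fscale ..
      then have "pmono m * p_prod B X' Y
          = (\<Sum>z\<in>H - Y. pscale (a z) (p_elt B (X' z))) * pmono n * p_prod B X' Y"
        by (simp only: n mono_single_Suc)
      also have "\<dots> = (\<Sum>z\<in>H - Y. pscale (a z) (pmono n * p_prod B X' (insert z Y)))"
        unfolding sum_distrib_right
      proof (rule sum.cong[OF refl])
        fix z assume "z \<in> H - Y"
        then have "p_prod B X' (insert z Y) = p_elt B (X' z) * p_prod B X' Y"
          using finY by (simp add: p_prod_def)
        then show "pscale (a z) (p_elt B (X' z)) * pmono n * p_prod B X' Y
            = pscale (a z) (pmono n * p_prod B X' (insert z Y))"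
          by (simp add: pscale_def mult_ac)
      qed
      \<comment> \<open>The cofactor \<open>pmono n\<close> has degree \<open>k\<close>, which is
        below the uniform bound \<open>Suc k\<close>.\<close>
      also have "\<dots> \<in> ?Q"
        using Y(1) nB deg n
        by (intro pm.subspace_sum[OF subspace_gspace] pm.subspace_scale[OF subspace_gspace]
            mono_mult_in_gspace) auto
      finally show ?thesis .
    qed
  qed
  moreover have "?Q \<subseteq> gspace B X' H ?c" by (rule gspace_mono) simp
  ultimately show ?thesis unfolding Q P_space_eq_gspace by (rule equalityI[rotated])
qed

lemma Hilb_R_space_mem:
  assumes "H \<in> J"
  shows "fps_X * Hilb (R_space k)
    = (\<Sum>j=0..k. fps_X ^ (j + 1) * Hilb (P_space B X' H (k - j) (J_hat I J i)))"
proof (induction k)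
  case 0
  then show ?case by (simp add: Hilb_R_space_0 Q_space_eq[OF assms])
next
  case (Suc k)
  show ?case
    by (simp add: Hilb_R_space_Suc Q_space_eq[OF assms] sum.atLeast0_atMost_Suc_shift Suc.IH
        ring_distribs sum_distrib_left mult.assoc del: sum.cl_ivl_Suc)
qed

text \<open>The recursion ends in \<open>Q_space 0 = {0}\<close>, so the summand
  \<open>j = k\<close> is absent; for \<open>j < k\<close> the argument \<open>k - j\<close> is
  positive and \<open>Q_space_Suc\<close> applies.\<close>

lemma Hilb_R_space_not_mem:
  assumes "H \<notin> J"
  shows "fps_X * Hilb (R_space k)
    = (\<Sum>j<k. fps_X ^ (j + 1) * Hilb (P_space B X' H (k - j) (J_hat I J i)))"
proof (induction k)
  case 0
  then show ?case by (simp add: Hilb_R_space_0 Q_space_0[OF assms] Hilb_zero_space)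
next
  case (Suc k)
  show ?case
    by (simp add: Hilb_R_space_Suc Q_space_Suc[OF assms] sum.lessThan_Suc_shift Suc.IH
        ring_distribs sum_distrib_left mult.assoc del: sum.lessThan_Suc)
qed

section \<open>The kernel for \<open>k = -1\<close>\<close>

lemma D_elt_insert:
  assumes "v \<in> W"
  shows "D_elt scale (insert e B) (v + scale c e) = D_elt scale B v + pscale c (var e)"
proof -
  let ?r = "representation (insert e B)"
  have ind: "independent (insert e B)" and sp: "span (insert e B) = V"
    using is_basisD[OF vs basis_insert] by auto
  have v: "v \<in> span B" "v \<in> span (insert e B)"
    using assms sp spanB by (auto simp: contr_space_def)
  have ee: "e \<in> span (insert e B)" "scale c e \<in> span (insert e B)"
    by (auto intro: span_base span_scale)
  have rv: "?r v = representation B v"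
    by (rule representation_extend[OF ind v(1)]) auto
  have rve: "representation B v e = 0"
    using representation_ne_zero[of B v e] e_notin_B by blast
  have r: "?r (v + scale c e) b = representation B v b + (if b = e then c else 0)" for b
    using ind v(2) ee
    by (simp add: representation_add representation_scale representation_basis rv)
  have "(\<Sum>b\<in>B. pscale (?r (v + scale c e) b) (var b))
      = (\<Sum>b\<in>B. pscale (representation B v b) (var b))"
    using e_notin_B by (intro sum.cong) (auto simp: r)
  then show ?thesis
    using finB e_notin_B by (simp add: D_elt_def r rve)
qed

lemma sym_act_D_elt_insert_power:
  assumes f: "f \<in> sym_alg B" and v: "v \<in> W"
  shows "sym_act (D_elt scale (insert e B) (v + scale c e) ^ n) f = sym_act (D_elt scale B v ^ n) f"
proof (induction n)
  case 0
  then show ?case by simp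
next
  case (Suc n)
  let ?g = "sym_act (D_elt scale B v ^ n) f"
  have "?g \<in> sym_alg B" by (rule sym_act_in_sym_alg[OF f])
  then have "sym_act (var e) ?g = 0" by (rule sym_act_var_eq_0[OF _ e_notin_B])
  then have "sym_act (pscale c (var e)) ?g = 0"
    by (metis mult.right_neutral mult.commute pscale_def sym_act_mult sym_act_0(2))
  then have "sym_act (D_elt scale (insert e B) (v + scale c e)) ?g = sym_act (D_elt scale B v) ?g"
    by (simp add: D_elt_insert[OF v] sym_act_add_left)
  then show ?case by (simp only: power_Suc sym_act_mult Suc.IH)
qed

text \<open>The exponent at \<open>k = -1\<close>; the shape \<open>+ -1\<close> is the literal
  instance of \<open>power_ideal\<close>, so unfolding identifies the two.\<close>

definition expo :: "'v \<Rightarrow> nat" where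
  "expo \<eta> = nat (int (card (I - flat_of X I \<eta>)) + -1 + int (chi X I J (flat_of X I \<eta>)))"

definition expo' :: "'v \<Rightarrow> nat" where
  "expo' v = nat (int (card (H - flat_of X' H v)) + -1
     + int (chi X' H (J_contr J i) (flat_of X' H v)))"

text \<open>The index \<open>i\<close> belongs to the flat of \<open>v\<close> in \<open>X\<close>,
  so both complements coincide and \<chi> is compared at a set containing \<open>i\<close>.\<close>

lemma expo_contr:
  assumes v: "v \<in> W"
  shows "expo v = expo' v"
proof -
  have "X i v = 0" using v by (simp add: contr_space_def)
  then have F: "flat_of X I v = insert i (flat_of X' H v)"
    using i X'_eq[OF v] by (auto simp: flat_of_def)
  have sub: "flat_of X' H v \<subseteq> H" by (auto simp: flat_of_def)
  have "I - insert i (flat_of X' H v) = H - flat_of X' H v" by blast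
  then show ?thesis
    unfolding expo_def expo'_def F by (simp add: chi_insert_coloop[OF sub])
qed

text \<open>Now \<open>i\<close> lies outside the flat, and its contribution to \<open>card\<close>
  cancels the -1.\<close>

lemma expo_transversal:
  assumes v: "v \<in> W" and c: "c \<noteq> 0"
  shows "expo (v + scale c e) = card (H - flat_of X' H v) + chi X I J (flat_of X' H v)"
proof -
  have vV: "v \<in> V" using v by (simp add: contr_space_def)
  have eV: "scale c e \<in> V" using subspace_V e(1) by (rule subspace_scale)
  have "X i (v + scale c e) = c"
    using X_add[OF i vV eV] X_scale[OF i e(1)] e(2) v by (simp add: contr_space_def)
  moreover have "X j (v + scale c e) = X' j v" if "j \<in> H" for j
    using that X_add[of j v "scale c e"] X_scale[of j e c] vV eV e(1,3) X'_eq[OF v] by simp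
  ultimately have "j \<in> flat_of X I (v + scale c e) \<longleftrightarrow> j \<in> flat_of X' H v" for j
    using c by (cases "j = i") (auto simp: flat_of_def)
  then have F: "flat_of X I (v + scale c e) = flat_of X' H v" by blast
  have "I - flat_of X' H v = insert i (H - flat_of X' H v)"
    using i by (auto simp: flat_of_def)
  then have "card (I - flat_of X' H v) = Suc (card (H - flat_of X' H v))"
    using fin by simp
  then show ?thesis by (simp add: expo_def F)
qed

lemma flat_of_0: "flat_of X' H 0 = H"
proof -
  have "0 \<in> V" using subspace_V by (rule subspace_0)
  then have "X j 0 = 0" if "j \<in> I" for j using X_scale[OF that, of 0 0] by simp
  then show ?thesis by (auto simp: flat_of_def contr_def restr_def)
qed

lemma zero_in_W: "0 \<in> W"
  using spanB span_zero by blast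

lemma expo_e: "expo e = chi X I J H"
  using expo_transversal[OF zero_in_W, of 1] by (simp add: flat_of_0)

text \<open>The -1 in \<open>expo'\<close> compensates its indicator, which is at most 1.\<close>

lemma expo'_le: "v \<in> W \<Longrightarrow> c \<noteq> 0 \<Longrightarrow> expo' v \<le> expo (v + scale c e)"
  using chi_le_1[of X' H "J_contr J i" "flat_of X' H v"]
  by (simp add: expo_transversal) (simp add: expo'_def)

abbreviation K :: "('v, 'a) mpoly set" where
  "K \<equiv> ker (insert e B) (power_ideal scale (insert e B) X I (-1) J)"

abbreviation K' :: "('v, 'a) mpoly set" where
  "K' \<equiv> ker B (power_ideal scale B X' H (-1) (J_contr J i))"

lemma K_eq: "K = {f \<in> sym_alg (insert e B).
    \<forall>\<eta>\<in>V - {0}. sym_act (D_elt scale (insert e B) \<eta> ^ expo \<eta>) f = 0}"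
  unfolding ker_power_ideal expo_def using is_basisD(3)[OF vs basis_insert] by simp

lemma K'_eq: "K' = {f \<in> sym_alg B. \<forall>v\<in>W - {0}. sym_act (D_elt scale B v ^ expo' v) f = 0}"
  unfolding ker_power_ideal expo'_def spanB ..

lemma D_elt_e: "D_elt scale (insert e B) e = var e"
proof -
  have "D_elt scale B 0 = 0" by (simp add: D_elt_def representation_zero)
  then show ?thesis using D_elt_insert[OF zero_in_W, of 1] by simp
qed

lemma e_nonzero: "e \<noteq> 0"
  using e_notin_W zero_in_W by blast

lemma K_not_mem:
  assumes "H \<notin> J"
  shows "K = {0}"
proof -
  have "expo e = 0" by (simp add: expo_e chi_eq_0[OF assms])
  then have "f = 0" if "f \<in> K" for f
    using that e(1) e_nonzero sym_act_one[of f] unfolding K_eq by force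
  then show ?thesis using pm.subspace_0[OF subspace_ker] by blast
qed

text \<open>Write \<open>\<eta>\<close> as \<open>v + scale c e\<close>. On \<open>f\<close> it acts
  like \<open>v\<close>, and the exponent of \<open>\<eta>\<close> is at least that of
  \<open>v\<close>, so its power factors through one that kills \<open>f\<close>.\<close>

lemma K'_sub_K:
  assumes mem: "H \<in> J"
  shows "K' \<subseteq> K"
proof
  fix f assume "f \<in> K'"
  then have f: "f \<in> sym_alg B"
    and ker: "\<And>v. v \<in> W \<Longrightarrow> v \<noteq> 0 \<Longrightarrow> sym_act (D_elt scale B v ^ expo' v) f = 0"
    unfolding K'_eq by auto
  have "sym_act (D_elt scale (insert e B) \<eta> ^ expo \<eta>) f = 0" if \<eta>: "\<eta> \<in> V" "\<eta> \<noteq> 0" for \<eta>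
  proof -
    define c where "c = X i \<eta>"
    define v where "v = \<eta> - scale c e"
    have v: "v \<in> W" using decompose[OF \<eta>(1)] by (simp add: v_def c_def)
    have \<eta>_eq: "\<eta> = v + scale c e" by (simp add: v_def)
    have act: "sym_act (D_elt scale (insert e B) \<eta> ^ expo \<eta>) f = sym_act (D_elt scale B v ^ expo \<eta>) f"
      unfolding \<eta>_eq by (rule sym_act_D_elt_insert_power[OF f v])
    show ?thesis
    proof (cases "v = 0")
      \<comment> \<open>At \<open>v = 0\<close> membership in \<open>K'\<close> gives no condition.
        Since \<open>H\<close> is in \<open>J\<close>, the exponent is 1 rather than 0, and
        \<open>D_elt scale B 0\<close> is 0.\<close>
      case True
      then have "c \<noteq> 0" using \<eta>(2) \<eta>_eq by auto
      then have "expo \<eta> = 1"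
        using expo_transversal[OF v, of c] mem H_flat(1) True by (simp add: \<eta>_eq flat_of_0 chi_def)
      moreover have "D_elt scale B v = 0" by (simp add: True D_elt_def representation_zero)
      ultimately show ?thesis using act by simp
    next
      case False
      have "expo' v \<le> expo \<eta>"
        using expo_contr[OF v] expo'_le[OF v, of c] by (cases "c = 0") (auto simp: \<eta>_eq)
      then have "D_elt scale B v ^ expo \<eta> = D_elt scale B v ^ (expo \<eta> - expo' v) * D_elt scale B v ^ expo' v"
        by (simp add: power_add[symmetric])
      then show ?thesis using act ker[OF v False] by (simp add: sym_act_mult)
    qed
  qed
  moreover have "f \<in> sym_alg (insert e B)" using f sym_alg_mono[of B "insert e B"] by blast
  ultimately show "f \<in> K" unfolding K_eq by simp
qed

end

text \<open>Stated outside the locale, whose scalars form an arbitrary field: deducing from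
  \<open>sym_act (var e) f = 0\<close> that \<open>f\<close> is free of \<open>e\<close> takes
  characteristic zero.\<close>

lemma K_eq_K':
  fixes scale :: "'a::field_char_0 \<Rightarrow> 'v::ab_group_add \<Rightarrow> 'v"
  assumes "coloop scale V B e X I i J" and mem: "I - {i} \<in> J"
  shows "ker (insert e B) (power_ideal scale (insert e B) X I (-1) J)
    = ker B (power_ideal scale B (contr V X i) (I - {i}) (-1) (J_contr J i))"
proof -
  interpret coloop scale V B e X I i J by fact
  have "K \<subseteq> K'"
  proof
    fix f assume "f \<in> K"
    then have f: "f \<in> sym_alg (insert e B)"
      and ker: "\<And>\<eta>. \<eta> \<in> V \<Longrightarrow> \<eta> \<noteq> 0 \<Longrightarrow> sym_act (D_elt scale (insert e B) \<eta> ^ expo \<eta>) f = 0"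
      unfolding K_eq by auto
    have "expo e = 1" using mem H_flat(1) by (simp add: expo_e chi_def)
    then have "sym_act (var e) f = 0" using ker[OF e(1) e_nonzero] by (simp add: D_elt_e)
    then have fB: "f \<in> sym_alg B" by (rule sym_alg_of_sym_act_var[OF f])
    have "sym_act (D_elt scale B v ^ expo' v) f = 0" if v: "v \<in> W" "v \<noteq> 0" for v
    proof -
      have "v \<in> V" using v(1) by (simp add: contr_space_def)
      then show ?thesis
        using ker[of v] v(2) sym_act_D_elt_insert_power[OF fB v(1), of 0] expo_contr[OF v(1)] by simp
    qed
    then show "f \<in> K'" using fB unfolding K'_eq by simp
  qed
  then show ?thesis using K'_sub_K[OF mem] by (rule equalityI)
qed

theorem theorem5p2:
  fixes scale :: "'a::field_char_0 \<Rightarrow> 'v::ab_group_add \<Rightarrow> 'v"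
    and V B B' :: "'v set" and r N i :: nat
    and X :: "nat \<Rightarrow> 'v \<Rightarrow> 'a" and J :: "nat set set"
  assumes "vector_space scale"
    and "is_basis scale V B"
    and "vector_space.dim scale V = r" and "r \<ge> 1"
    and "\<forall>j\<in>{1..N}. X j \<in> dual_space scale V"
    and "fn.span (X ` {1..N}) = dual_space scale V"
    and "upper_set X {1..N} J" and "J \<noteq> {}"
    and "i \<in> {1..N}" and "rank X ({1..N} - {i}) = r - 1"
    and "is_basis scale (contr_space V (X i)) B'"
  shows
    "(\<forall>k::nat. Hilb (P_space B X {1..N} k J) =
        (if {1..N} - {i} \<in> J then
           (\<Sum>j=0..k. fps_X ^ (j + 1) *
              Hilb (P_space B' (contr V X i) ({1..N} - {i}) (k - j) (J_hat {1..N} J i)))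
           + Hilb (P_space B' (contr V X i) ({1..N} - {i}) k (J_contr J i))
         else
           (\<Sum>j<k. fps_X ^ (j + 1) *
              Hilb (P_space B' (contr V X i) ({1..N} - {i}) (k - j) (J_hat {1..N} J i)))
           + Hilb (P_space B' (contr V X i) ({1..N} - {i}) k (J_contr J i))))
     \<and> Hilb (ker B (power_ideal scale B X {1..N} (-1) J)) =
        (if {1..N} - {i} \<in> J then
           Hilb (ker B' (power_ideal scale B' (contr V X i) ({1..N} - {i}) (-1) (J_contr J i)))
         else 0)"
proof -
  interpret vs: vector_space scale by fact
  let ?H = "{1..N} - {i}"
  have X: "X j \<in> dual_space scale V" if "j \<in> {1..N}" for j using assms(5) that by blast
  \<comment> \<open>The whole sequence has rank \<open>r\<close>, the rest has rank
    \<open>r - 1\<close>, and these differ by \<open>r \<ge> 1\<close>; hence \<open>X i\<close> is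
    outside the span of the rest.\<close>
  have "card B = r"
    using is_basisD[OF assms(1,2)] assms(3) vs.dim_span_eq_card_independent by metis
  then have "fn.dim (X ` {1..N}) = r"
    using dim_dual_space[OF assms(1,2)] assms(6) fn.dim_span by metis
  then have "fn.dim (insert (X i) (X ` ?H)) \<noteq> fn.dim (X ` ?H)"
    using assms(4,9,10) by (simp add: rank_def image_insert[symmetric] insert_absorb del: image_insert)
  then have "X i \<notin> fn.span (X ` ?H)"
    by (simp add: fn.dim_insert_eq_iff)
  then obtain e where e: "e \<in> V" "X i e = 1" "\<And>u. u \<in> X ` ?H \<Longrightarrow> u e = 0"
    using coloop_functional[OF assms(1,2), of "X ` ?H" "X i"] X assms(9) by blast
  have "vs.subspace V" using is_basisD(3)[OF assms(1,2)] by auto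
  then have loc: "coloop scale V B' e X {1..N} i J"
    using assms e X by unfold_locales auto
  interpret coloop scale V B' e X "{1..N}" i J by (rule loc)
  \<comment> \<open>The given basis \<open>B\<close> is exchanged for the adapted one; the
    contracted spaces are already written in \<open>B'\<close>.\<close>
  have P: "Hilb (P_space B X {1..N} k J) = Hilb (P_space (insert e B') X {1..N} k J)" for k
    unfolding P_space_eq_gspace by (rule Hilb_gspace_basis[OF assms(1,2) basis_insert X])
  have K: "Hilb (ker B (power_ideal scale B X {1..N} (-1) J)) = Hilb K"
    by (rule Hilb_ker_basis[OF assms(1,2) basis_insert])
  show ?thesis
  proof (cases "?H \<in> J")
    case True
    then show ?thesis
      by (simp only: if_True simp_thms K P Hilb_P_space Hilb_R_space_mem K_eq_K'[OF loc] add.commute)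
  next
    case False
    then show ?thesis
      by (simp only: if_False simp_thms K P Hilb_P_space Hilb_R_space_not_mem K_not_mem
          Hilb_zero_space add.commute)
  qed
qed

end
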